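(* For $z \in \mathbb{C}$ let $W_{j}(a,z)$ ($j=0,3$) be as below, and $\hat{N}_{W}(a,z)$ be the analytically continued complementary Nield-Kuznetsov function. Let $N_{W}(a,z)$ be the Nield-Kuznetsov function with $W$ extended to complex argument. Then \[ N_{W}(a,z)=c_{0}^{(0)}(a)W_{0}(a,z)+c_{0}^{(3)}(a)W_{3}(a,z)-\hat{N}_{W}(a,z), \] where \[ c_{0}^{(0)}(a)=\frac {\sqrt {\pi}2^{\frac{5}{4}+\frac{1}{2}ia}e^{ \frac{1}{2}\pi a+\frac{3}{4}\pi i}Y(a)}{\Gamma\left( \frac{1}{4}-\frac{1}{2}ia \right) }+2^{-\frac{5}{4}+\frac{1}{2}ia}e^{ \frac{1}{2}\pi a+\frac{1}{4}\pi i}\Gamma\left( \tfrac{1}{4}+\tfrac{1}{2}ia \right), \] $c_{0}^{(3)}(a)=\overline{c_{0}^{(0)}(a)}$, and $Y(a)= \Im\{ (1-2ia)^{-1}F(\tfrac{1}{2}, 1;\tfrac{5}{4}-\tfrac{1}{2}ia;\tfrac{1}{2})\}$ with $F$ the Gauss hypergeometric function.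
   Context: $a$ is real. $U(a,z)$ is the standard parabolic cylinder function (solution of $y''-(\tfrac14 z^2+a)y=0$ recessive as $z\to+\infty$). $W_{j}(a,z)=U\left((-1)^{j}ia,(-i)^{j}ze^{-\pi i/4}\right)$, $j=0,3$, solutions of $y''+(\tfrac14 z^2-a)y=0$. The Weber function is extended to complex $z$ by $W(a,z)=\sqrt{\tfrac{1}{2}k}\, e^{\pi a/4}\{ e^{i\rho}W_{0}(a,z)+e^{-i\rho }W_{3}(a,z)\}$, $k=\sqrt{1+e^{2\pi a}}-e^{\pi a}$, $\rho=\tfrac12\arg\Gamma(\tfrac12+ia)+\tfrac18\pi$. For real $x$, $N_{W}(a,x)=W(a,x) \int_{0}^x W(a,-t)dt-W(a,-x)\int_{0}^x W(a,t)dt$, extended to $x=z$ complex. The complementary function is $\hat{N}_{W}(a,z)=ie^{\pi a/2}[W_{3}(a,z)\int_{e^{\pi i/4}\infty}^z W_{0}(a,t)dt-W_{0}(a,z) \int_{e^{-\pi i/4}\infty}^z W_{3}(a,t)dt]$, which for real $z=x$ equals $W(a,x)\int_{x}^{\infty} W(a,-t)dt-W(a,-x) \int_{x}^{\infty} W(a,t)dt$. *)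

theory Defs
  imports "HOL-Complex_Analysis.Complex_Analysis"
begin

definition kummerM :: "complex \<Rightarrow> complex \<Rightarrow> complex \<Rightarrow> complex" where
  "kummerM a b z = (\<Sum>n. pochhammer a n / (pochhammer b n * fact n) * z ^ n)"

definition gaussF :: "complex \<Rightarrow> complex \<Rightarrow> complex \<Rightarrow> complex \<Rightarrow> complex" where
  "gaussF a b c z = (\<Sum>n. pochhammer a n * pochhammer b n / (pochhammer c n * fact n) * z ^ n)"

(* Standard parabolic cylinder function U(a,z) for complex a, z (DLMF 12.4.1, 12.2.6-7, 12.7.12-13):
   U(a,z) = U(a,0) u1(a,z) + U'(a,0) u2(a,z),
   u1 = e^{-z^2/4} M(a/2+1/4, 1/2, z^2/2),  u2 = z e^{-z^2/4} M(a/2+3/4, 3/2, z^2/2),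
   U(a,0) = sqrt pi / (2^(a/2+1/4) Gamma(3/4+a/2)),  U'(a,0) = - sqrt pi / (2^(a/2-1/4) Gamma(1/4+a/2)). *)
definition pcfU :: "complex \<Rightarrow> complex \<Rightarrow> complex" where
  "pcfU a z =
     complex_of_real (sqrt pi) * rGamma (3/4 + a/2) / (2 powr (a/2 + 1/4))
       * (exp (- (z ^ 2) / 4) * kummerM (a/2 + 1/4) (1/2) ((z ^ 2) / 2))
   - complex_of_real (sqrt pi) * rGamma (1/4 + a/2) / (2 powr (a/2 - 1/4))
       * (z * exp (- (z ^ 2) / 4) * kummerM (a/2 + 3/4) (3/2) ((z ^ 2) / 2))"

definition Wj :: "nat \<Rightarrow> real \<Rightarrow> complex \<Rightarrow> complex" where
  "Wj j a z = pcfU ((-1)^j * \<i> * complex_of_real a) ((-\<i>)^j * z * exp (- pi * \<i> / 4))"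

definition weber_k :: "real \<Rightarrow> real" where
  "weber_k a = sqrt (1 + exp (2 * pi * a)) - exp (pi * a)"

(* rho = 1/2 arg Gamma(1/2 + i a) + pi/8, where arg Gamma(1/2+ia) is the continuous branch
   vanishing at a = 0, i.e. Im (ln Gamma(1/2 + i a)) *)
definition weber_rho :: "real \<Rightarrow> real" where
  "weber_rho a = Im (ln_Gamma (1/2 + \<i> * complex_of_real a)) / 2 + pi / 8"

definition weberW :: "real \<Rightarrow> complex \<Rightarrow> complex" where
  "weberW a z = complex_of_real (sqrt (weber_k a / 2) * exp (pi * a / 4)) *
     (exp (\<i> * weber_rho a) * Wj 0 a z + exp (- \<i> * weber_rho a) * Wj 3 a z)"

definition NW :: "real \<Rightarrow> complex \<Rightarrow> complex" where
  "NW a z = weberW a z * contour_integral (linepath 0 z) (\<lambda>t. weberW a (- t))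
          - weberW a (- z) * contour_integral (linepath 0 z) (\<lambda>t. weberW a t)"

definition ray_integral :: "(complex \<Rightarrow> complex) \<Rightarrow> complex \<Rightarrow> real \<Rightarrow> complex" where
  "ray_integral f z \<theta> =
     Lim at_top (\<lambda>R::real. contour_integral (linepath z (complex_of_real R * exp (\<i> * \<theta>))) f)"

definition NW_hat :: "real \<Rightarrow> complex \<Rightarrow> complex" where
  "NW_hat a z = \<i> * exp (complex_of_real (pi * a / 2)) *
     (Wj 3 a z * (- ray_integral (Wj 0 a) z (pi / 4))
      - Wj 0 a z * (- ray_integral (Wj 3 a) z (- pi / 4)))"

definition Yfun :: "real \<Rightarrow> real" where
  "Yfun a = Im (inverse (1 - 2 * \<i> * complex_of_real a) *
                gaussF (1/2) 1 (5/4 - \<i> * complex_of_real a / 2) (1/2))"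

definition c00 :: "real \<Rightarrow> complex" where
  "c00 a =
     complex_of_real (sqrt pi) * 2 powr (5/4 + \<i> * complex_of_real a / 2)
       * exp (complex_of_real (pi * a / 2) + 3 * pi * \<i> / 4) * complex_of_real (Yfun a)
       / Gamma (1/4 - \<i> * complex_of_real a / 2)
   + 2 powr (- 5/4 + \<i> * complex_of_real a / 2)
       * exp (complex_of_real (pi * a / 2) + pi * \<i> / 4)
       * Gamma (1/4 + \<i> * complex_of_real a / 2)"

definition c03 :: "real \<Rightarrow> complex" where
  "c03 a = cnj (c00 a)"

end

theory Submission
  imports Defs
begin

text \<open>
  All solutions involved are combinations of one even and one odd entire solution, so the
  definition of \<open>NW\<close> collapses to \<open>i exp(\<pi>a/2) (W\<^sub>0 \<integral>W\<^sub>3 - W\<^sub>3 \<integral>W\<^sub>0)\<close> with primitives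
  based at 0, once the connection coefficients are evaluated by the reflection and duplication
  formulas for \<open>\<Gamma>\<close>. Adding \<open>NW_hat\<close> moves the base points to infinity and leaves the two
  constants \<open>\<integral>\<^sub>0\<^sup>\<infinity> U(\<plusminus>ia, s) ds\<close>.

  With \<open>b = 2p - 1/2\<close>, the integral representation of \<open>U(b, s)\<close> turns the constant into a double
  integral over the quadrant; scaling \<open>s = t x\<close> reduces it to the integral of
  \<open>(x\<^sup>2/4 + x + 1/2)\<close> to the power \<open>-(p + 1/2)\<close>, which a substitution identifies with a multiple of
  \<open>H(p)\<close>, the integral of \<open>u powr (p - 1) / sqrt (1 + u)\<close> over \<open>(0, 1)\<close> (\<open>half_beta\<close> below).
  Expanding around \<open>u = 1\<close> gives the hypergeometric value in \<open>Yfun\<close>. For purely imaginary \<open>b\<close> the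
  conjugate of \<open>H(p)\<close> is \<open>H(1/2 - p)\<close>, and their sum is a complete Beta integral: this is why only
  the imaginary part of the hypergeometric value survives, next to a pure Gamma term.
\<close>

section \<open>Iterated integrals over the quadrant\<close>

text \<open>Swap the order, substitute \<open>s = t * x\<close> in the inner integral for fixed
  \<open>t\<close>, and swap back. The shear pays off when the exponent of \<open>F\<close> is
  homogeneous in both variables, because the \<open>t\<close>-integral is then elementary.\<close>

lemma homogeneous_Fubini:
  fixes F :: "real \<Rightarrow> real \<Rightarrow> complex"
  assumes F: "integrable (lborel \<Otimes>\<^sub>M lborel) (case_prod F)"
  shows "(\<integral>s. (\<integral>t. F t s \<partial>lborel) \<partial>lborel) = (\<integral>x. (\<integral>t. \<bar>t\<bar> *\<^sub>R F t (t * x) \<partial>lborel) \<partial>lborel)"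
proof -
  have [measurable]: "case_prod F \<in> borel_measurable (lborel \<Otimes>\<^sub>M lborel)"
    using F by (rule borel_measurable_integrable)
  have [measurable]: "(\<lambda>p. F (fst p) (fst p * snd p)) \<in> borel_measurable (lborel \<Otimes>\<^sub>M lborel)"
    using measurable_compose[of "\<lambda>p. (fst p, fst p * snd p)" "lborel \<Otimes>\<^sub>M lborel" "lborel \<Otimes>\<^sub>M lborel" "case_prod F" borel]
    by (simp add: case_prod_beta)
  define G where "G t x = \<bar>t\<bar> *\<^sub>R F t (t * x)" for t x
  have Gm [measurable]: "case_prod G \<in> borel_measurable (lborel \<Otimes>\<^sub>M lborel)"
    unfolding G_def case_prod_beta by measurable
  \<comment> \<open>The shear degenerates at \<open>t = 0\<close>; off this null set the affine
    substitution is available.\<close>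
  have ae0: "AE t in lborel. t \<noteq> (0::real)"
    by (simp add: AE_lborel_singleton)
  have aeF: "AE t in lborel. integrable lborel (F t)"
    using lborel_pair.AE_integrable_fst'[OF F] by simp
  have intG: "AE t in lborel. integrable lborel (G t)"
    using ae0 aeF
  proof eventually_elim
    case (elim t)
    then show ?case
      unfolding G_def using lborel_integrable_real_affine[of "F t" t 0] by simp
  qed
  have eqG: "AE t in lborel. (\<integral>x. G t x \<partial>lborel) = (\<integral>s. F t s \<partial>lborel)"
    using ae0
  proof eventually_elim
    case (elim t)
    then show ?case
      unfolding G_def using lborel_integral_real_affine[of t "F t" 0] by simp
  qed
  \<comment> \<open>The same substitution applied to norms carries integrability from
    \<open>F\<close> to the sheared function, as the second swap requires.\<close>
  have eqnG: "AE t in lborel. (\<integral>s. norm (F t s) \<partial>lborel) = (\<integral>x. norm (G t x) \<partial>lborel)"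
    using ae0
  proof eventually_elim
    case (elim t)
    then show ?case
      unfolding G_def using lborel_integral_real_affine[of t "\<lambda>s. norm (F t s)" 0] by simp
  qed
  have "integrable (lborel \<Otimes>\<^sub>M lborel) (case_prod G)"
  proof (rule lborel_pair.Fubini_integrable)
    have 1: "integrable lborel (\<lambda>t. \<integral>s. norm (F t s) \<partial>lborel)"
      using lborel_pair.integrable_fst'[OF integrable_norm[OF F]] by simp
    have "integrable lborel (\<lambda>t. \<integral>x. norm (G t x) \<partial>lborel)"
      by (rule integrable_cong_AE_imp[OF 1 _ eqnG]) measurable
    then show "integrable lborel (\<lambda>t. \<integral>x. norm (case (t, x) of (x, xa) \<Rightarrow> G x xa) \<partial>lborel)"
      by simp
  qed (use intG in simp_all)
  from lborel_pair.Fubini_integral[OF this]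
  have "(\<integral>x. (\<integral>t. G t x \<partial>lborel) \<partial>lborel) = (\<integral>t. (\<integral>x. G t x \<partial>lborel) \<partial>lborel)" .
  also have "\<dots> = (\<integral>t. (\<integral>s. F t s \<partial>lborel) \<partial>lborel)"
    by (rule integral_cong_AE) (use eqG in simp_all)
  also have "\<dots> = (\<integral>s. (\<integral>t. F t s \<partial>lborel) \<partial>lborel)"
    using lborel_pair.Fubini_integral[OF F] by simp
  finally show ?thesis unfolding G_def by simp
qed

section \<open>Change of variables and termwise integration for set integrals\<close>

lemma set_integrable_lborel_iff_absolutely_integrable:
  fixes f :: "real \<Rightarrow> complex"
  assumes "set_borel_measurable borel S f"
  shows "set_integrable lborel S f \<longleftrightarrow> f absolutely_integrable_on S"
  using assms unfolding set_integrable_def set_borel_measurable_def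
  by (subst integrable_completion) auto

text \<open>The change of variables theorem speaks of absolute integrability; Borel measurability of
  both integrands carries it over to \<open>lborel\<close>. The separate function \<open>k\<close>,
  tied to the transformed integrand only on \<open>S\<close>, lets the latter be given in closed
  form.\<close>

lemma set_lebesgue_integral_substitution:
  fixes f :: "real \<Rightarrow> complex" and g h :: "real \<Rightarrow> real"
  assumes S: "S \<in> sets borel"
    and der: "\<And>x. x \<in> S \<Longrightarrow> (g has_real_derivative h x) (at x within S)"
    and inj: "inj_on g S"
    and f: "set_borel_measurable borel (g ` S) f"
    and k: "set_borel_measurable borel S k"
    and eq: "\<And>x. x \<in> S \<Longrightarrow> k x = \<bar>h x\<bar> *\<^sub>R f (g x)"
  shows "set_integrable lborel S k \<longleftrightarrow> set_integrable lborel (g ` S) f"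
    and "(LINT x:S|lborel. k x) = (LINT x:g ` S|lborel. f x)"
proof -
  have S': "S \<in> sets lebesgue" using S by simp
  have "set_integrable lborel S k \<longleftrightarrow> k absolutely_integrable_on S"
    by (rule set_integrable_lborel_iff_absolutely_integrable[OF k])
  also have "\<dots> \<longleftrightarrow> (\<lambda>x. \<bar>h x\<bar> *\<^sub>R f (g x)) absolutely_integrable_on S"
    by (rule set_integrable_cong) (use eq in auto)
  also have "\<dots> \<longleftrightarrow> f absolutely_integrable_on (g ` S)"
    by (rule absolutely_integrable_change_of_variables_real[symmetric, OF S' der inj])
  also have "\<dots> \<longleftrightarrow> set_integrable lborel (g ` S) f"
    by (rule set_integrable_lborel_iff_absolutely_integrable[OF f, symmetric])
  finally show iff: "set_integrable lborel S k \<longleftrightarrow> set_integrable lborel (g ` S) f" .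
  show "(LINT x:S|lborel. k x) = (LINT x:g ` S|lborel. f x)"
  proof (cases "set_integrable lborel S k")
    case True
    then have F: "set_integrable lborel (g ` S) f" using iff by simp
    have "f absolutely_integrable_on (g ` S)"
      using F set_integrable_lborel_iff_absolutely_integrable[OF f] by simp
    then have "integral S (\<lambda>x. \<bar>h x\<bar> *\<^sub>R f (g x)) = integral (g ` S) f"
      using has_absolute_integral_change_of_variables_real[OF S' der inj, of f "integral (g ` S) f"] by simp
    moreover have "integral S (\<lambda>x. \<bar>h x\<bar> *\<^sub>R f (g x)) = integral S k"
      by (rule integral_cong) (simp add: eq)
    ultimately show ?thesis
      using set_borel_integral_eq_integral(2)[OF True] set_borel_integral_eq_integral(2)[OF F] by simp
  next
    \<comment> \<open>Neither side is integrable, so both integrals have the default value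
      0.\<close>
    case False
    with iff show ?thesis
      unfolding set_integrable_def set_lebesgue_integral_def
      by (simp add: not_integrable_integral_eq)
  qed
qed

lemma set_borel_measurable_continuous_open:
  fixes f :: "real \<Rightarrow> complex"
  assumes "open S" "continuous_on S f"
  shows "set_borel_measurable borel S f"
  using assms by (simp add: borel_measurable_continuous_on_indicator borel_open set_borel_measurable_def)

lemma powr_of_real_eq_exp: "0 < x \<Longrightarrow> complex_of_real x powr z = exp (z * of_real (ln x))"
  by (simp add: powr_def Ln_of_real)

lemma pochhammer_nonzero: "Re z > 0 \<Longrightarrow> pochhammer z n \<noteq> 0"
  by (auto simp: pochhammer_eq_0_iff)

lemma powr_of_real_mult:
  "0 < x \<Longrightarrow> 0 < y \<Longrightarrow> complex_of_real (x * y) powr z = of_real x powr z * of_real y powr z"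
  by (simp add: powr_of_real_eq_exp ln_mult ring_distribs exp_add del: of_real_mult)

lemma continuous_on_of_real_powr:
  assumes "continuous_on S q" "\<And>x. x \<in> S \<Longrightarrow> 0 < q x"
  shows "continuous_on S (\<lambda>x. complex_of_real (q x) powr w)"
  using assms by (intro continuous_on_powr_complex continuous_intros) (fastforce simp: complex_nonpos_Reals_iff)+

lemma norm_of_real_powr: "0 < x \<Longrightarrow> norm (complex_of_real x powr z) = x powr Re z"
  by (simp add: norm_powr_real_powr)

text \<open>Dominated convergence for the partial sums. It serves the binomial series behind
  \<open>gaussF\<close> and the exponential series behind \<open>kummerM\<close>.\<close>

lemma set_integral_sums_dominated:
  fixes f :: "nat \<Rightarrow> real \<Rightarrow> complex"
  assumes f: "\<And>n. set_integrable lborel S (f n)" and w: "set_integrable lborel S w"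
    and g: "set_borel_measurable borel S g"
    and sums: "\<And>v. v \<in> S \<Longrightarrow> (\<lambda>n. f n v) sums g v"
    and le: "\<And>N v. v \<in> S \<Longrightarrow> norm (\<Sum>n<N. f n v) \<le> w v"
  shows "(\<lambda>n. LINT v:S|lborel. f n v) sums (LINT v:S|lborel. g v)"
proof -
  let ?s = "\<lambda>N v. indicator S v *\<^sub>R (\<Sum>n<N. f n v)"
  have I: "integrable lborel (?s N)" for N
    using f unfolding set_integrable_def scaleR_sum_right by (intro Bochner_Integration.integrable_sum) auto
  have "(\<lambda>N. integral\<^sup>L lborel (?s N)) \<longlonglongrightarrow> integral\<^sup>L lborel (\<lambda>v. indicator S v *\<^sub>R g v)"
  proof (rule integral_dominated_convergence[where f = "\<lambda>v. indicator S v *\<^sub>R g v" and s = ?s and w = "\<lambda>v. indicator S v *\<^sub>R w v"])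
    show "AE v in lborel. (\<lambda>N. ?s N v) \<longlonglongrightarrow> indicator S v *\<^sub>R g v"
      using sums by (intro AE_I2) (auto simp: indicator_def sums_def)
    show "AE v in lborel. norm (?s N v) \<le> indicator S v *\<^sub>R w v" for N
      using le by (intro AE_I2) (auto simp: indicator_def)
    show "?s N \<in> borel_measurable lborel" for N
      using I by (rule borel_measurable_integrable)
  qed (use w g in \<open>simp_all add: set_integrable_def set_borel_measurable_def\<close>)
  moreover have "integral\<^sup>L lborel (?s N) = (\<Sum>n<N. LINT v:S|lborel. f n v)" for N
    using f unfolding set_integrable_def set_lebesgue_integral_def scaleR_sum_right
    by (intro Bochner_Integration.integral_sum) auto
  ultimately show ?thesis
    by (simp add: sums_def set_lebesgue_integral_def)
qed

section \<open>Mellin integrals of exponentials and Gaussians\<close>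

lemma Gamma_integral_scaled:
  assumes z: "Re z > 0" and q: "q > (0::real)"
  defines "f \<equiv> \<lambda>t::real. of_real t powr (z - 1) * of_real (exp (- q * t))"
  shows "set_integrable lborel {0<..} f"
    and "(LINT t:{0<..}|lborel. f t) = of_real q powr (- z) * Gamma z"
proof -
  let ?f = "\<lambda>t::real. complex_of_real t powr (z - 1) / of_real (exp t)"
  let ?k = "\<lambda>t::real. of_real q powr z * f t"
  have img: "(\<lambda>t. q * t) ` {0<..} = {0<..}"
    using q by (auto simp: image_iff intro!: bexI[of _ "x / q" for x])
  have m1: "set_borel_measurable borel {0<..} ?f"
    by (intro set_borel_measurable_continuous_open) (auto intro!: continuous_intros)
  have m2: "set_borel_measurable borel {0<..} ?k"
    unfolding f_def by (intro set_borel_measurable_continuous_open) (auto intro!: continuous_intros)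
  have eq: "?k t = \<bar>q\<bar> *\<^sub>R ?f (q * t)" if "t \<in> {0<..}" for t
    using that q
    by (simp add: f_def powr_of_real_mult powr_diff exp_minus scaleR_conv_of_real field_simps flip: of_real_mult)
  have I: "set_integrable lborel {0<..} ?f"
    using absolutely_integrable_Gamma_integral'[OF z] set_integrable_lborel_iff_absolutely_integrable[OF m1] by simp
  have G: "(LINT t:{0<..}|lborel. ?f t) = Gamma z"
    using set_borel_integral_eq_integral(2)[OF I] Gamma_integral_complex'[OF z]
    by (simp add: integral_unique)
  have der: "\<And>x. x \<in> {0<..} \<Longrightarrow> ((\<lambda>t. q * t) has_real_derivative q) (at x within {0<..})"
    by (auto intro!: derivative_eq_intros)
  have inj: "inj_on (\<lambda>t. q * t) {0<..}" using q by (auto simp: inj_on_def)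
  have 1: "set_integrable lborel {0<..} ?k" "(LINT t:{0<..}|lborel. ?k t) = Gamma z"
    using set_lebesgue_integral_substitution[of "{0<..}" "\<lambda>t. q * t" "\<lambda>_. q" ?f ?k, OF _ der inj _ m2 eq] m1 I G
    unfolding img by auto
  show "set_integrable lborel {0<..} f"
    using 1(1) q by simp
  have "of_real q powr z * (LINT t:{0<..}|lborel. f t) = Gamma z"
    using 1(2) q by simp
  then show "(LINT t:{0<..}|lborel. f t) = of_real q powr (- z) * Gamma z"
    using q by (simp add: powr_minus field_simps)
qed

text \<open>Taking t^2 as the new variable reduces this to \<open>Gamma_integral_scaled\<close> at
  \<open>c / 2\<close>; the derivative \<open>2 * t\<close> causes the halving.\<close>

lemma Gaussian_Mellin:
  assumes c: "Re c > 0" and q: "q > (0::real)"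
  defines "f \<equiv> \<lambda>t::real. of_real t powr (c - 1) * of_real (exp (- q * t\<^sup>2))"
  shows "set_integrable lborel {0<..} f"
    and "(LINT t:{0<..}|lborel. f t) = of_real q powr (- (c / 2)) * Gamma (c / 2) / 2"
proof -
  let ?f = "\<lambda>t::real. of_real t powr (c / 2 - 1) * complex_of_real (exp (- q * t))"
  let ?k = "\<lambda>t::real. 2 * f t"
  have img: "(\<lambda>t::real. t\<^sup>2) ` {0<..} = {0<..}"
    by (auto simp: image_iff) (metis greaterThan_iff real_sqrt_gt_zero real_sqrt_pow2 less_imp_le)
  have m1: "set_borel_measurable borel {0<..} ?f"
    by (intro set_borel_measurable_continuous_open) (auto intro!: continuous_intros)
  have m2: "set_borel_measurable borel {0<..} ?k"
    unfolding f_def by (intro set_borel_measurable_continuous_open) (auto intro!: continuous_intros)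
  have eq: "?k t = \<bar>2 * t\<bar> *\<^sub>R ?f (t\<^sup>2)" if "t \<in> {0<..}" for t
  proof -
    have t: "t > 0" using that by simp
    have "complex_of_real (t\<^sup>2) powr (c / 2 - 1) * of_real t = of_real t powr (c - 1)"
      using t powr_add[of "complex_of_real t" "c / 2 - 1" "c / 2 - 1"] powr_add[of "complex_of_real t" "c - 2" 1]
      by (simp add: power2_eq_square powr_of_real_mult del: of_real_mult)
    then show ?thesis using t by (simp add: f_def scaleR_conv_of_real algebra_simps)
  qed
  have c': "Re (c / 2) > 0" using c by simp
  note G = Gamma_integral_scaled[OF c' q]
  have der: "\<And>x::real. x \<in> {0<..} \<Longrightarrow> ((\<lambda>t. t\<^sup>2) has_real_derivative 2 * x) (at x within {0<..})"
    by (auto intro!: derivative_eq_intros)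
  have inj: "inj_on (\<lambda>t::real. t\<^sup>2) {0<..}" by (auto simp: inj_on_def)
  have 1: "set_integrable lborel {0<..} ?k" "(LINT t:{0<..}|lborel. ?k t) = of_real q powr (- (c / 2)) * Gamma (c / 2)"
    using set_lebesgue_integral_substitution[of "{0<..}" "\<lambda>t. t\<^sup>2" "\<lambda>t. 2 * t" ?f ?k, OF _ der inj _ m2 eq] m1 G
    unfolding img by auto
  show "set_integrable lborel {0<..} f"
    using 1(1) by simp
  show "(LINT t:{0<..}|lborel. f t) = of_real q powr (- (c / 2)) * Gamma (c / 2) / 2"
    using 1(2) by (simp add: mult.commute)
qed

lemma set_integrable_dominated_by:
  fixes f :: "real \<Rightarrow> complex" and g :: "real \<Rightarrow> real"
  assumes "set_integrable lborel S g" "set_borel_measurable borel S f"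
    and "\<And>x. x \<in> S \<Longrightarrow> norm (f x) \<le> g x"
  shows "set_integrable lborel S f"
  using assms unfolding set_integrable_def set_borel_measurable_def
  by (elim Bochner_Integration.integrable_bound) (auto simp: indicator_def intro!: AE_I2 order_trans[OF _ abs_ge_self])

lemma Gaussian_Mellin_real:
  assumes c: "c > 0" and q: "q > (0::real)"
  shows "set_integrable lborel {0<..} (\<lambda>t::real. t powr (c - 1) * exp (- q * t\<^sup>2))"
proof -
  have "set_integrable lborel {0<..} (\<lambda>t::real. norm (of_real t powr (complex_of_real c - 1) * of_real (exp (- q * t\<^sup>2))))"
    using c q by (intro set_integrable_norm Gaussian_Mellin) auto
  also have "?this \<longleftrightarrow> ?thesis"
    by (rule set_integrable_cong) (auto simp: norm_mult norm_of_real_powr)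
  finally show ?thesis .
qed

lemma integrable_lborel_times:
  fixes g h :: "real \<Rightarrow> 'a :: {real_normed_field, banach, second_countable_topology}"
  assumes g: "integrable lborel g" and h: "integrable lborel h"
  shows "integrable (lborel \<Otimes>\<^sub>M lborel) (\<lambda>(t, s). g t * h s)"
proof (rule lborel_pair.Fubini_integrable)
  have [measurable]: "g \<in> borel_measurable lborel" "h \<in> borel_measurable lborel"
    using g h by auto
  show "(\<lambda>(t, s). g t * h s) \<in> borel_measurable (lborel \<Otimes>\<^sub>M lborel)" by measurable
  show "AE t in lborel. integrable lborel (\<lambda>s. case (t, s) of (t, s) \<Rightarrow> g t * h s)"
    using h by simp
  show "integrable lborel (\<lambda>t. \<integral>s. norm (case (t, s) of (t, s) \<Rightarrow> g t * h s) \<partial>lborel)"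
    using g by (simp add: norm_mult)
qed

text \<open>Up to the factor \<open>rGamma (2 * p)\<close>, the integrand in the representation of \<open>U(2p - 1/2, s)\<close>.\<close>

definition parabolic_kernel :: "complex \<Rightarrow> real \<Rightarrow> real \<Rightarrow> complex" where
  "parabolic_kernel p t s = of_real t powr (2 * p - 1) * of_real (exp (- (s\<^sup>2 / 4) - t\<^sup>2 / 2 - s * t))"

text \<open>For positive \<open>s\<close> and \<open>t\<close> the mixed factor
  \<open>exp (- s * t)\<close> is at most 1, so a product of two one-dimensional Gaussian Mellin
  integrands is a majorant.\<close>

lemma integrable_parabolic_kernel:
  assumes p: "Re p > 0"
  shows "integrable (lborel \<Otimes>\<^sub>M lborel)
           (\<lambda>(t, s). indicator {0<..} t *\<^sub>R indicator {0<..} s *\<^sub>R parabolic_kernel p t s)"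
    (is "integrable _ (case_prod ?F)")
proof -
  let ?g = "\<lambda>t::real. indicator {0<..} t * (t powr (2 * Re p - 1) * exp (- (1/2) * t\<^sup>2))"
  \<comment> \<open>The factor \<open>s powr (1 - 1)\<close> is 1 on the half line; it gives the
    Gaussian the shape of \<open>Gaussian_Mellin_real\<close> with \<open>c = 1\<close>.\<close>
  let ?h = "\<lambda>s::real. indicator {0<..} s * (s powr (1 - 1) * exp (- (1/4) * s\<^sup>2))"
  have g: "integrable lborel ?g" and h: "integrable lborel ?h"
    using Gaussian_Mellin_real[of "2 * Re p" "1/2"] Gaussian_Mellin_real[of 1 "1/4"] p
    by (simp_all add: set_integrable_def)
  have m: "set_borel_measurable borel {0<..} (\<lambda>t. complex_of_real t powr (2 * p - 1))"
    by (intro set_borel_measurable_continuous_open) (auto intro!: continuous_intros)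
  have eqF: "case_prod ?F = (\<lambda>(t, s). indicator {0<..} s *\<^sub>R
     ((indicator {0<..} t *\<^sub>R of_real t powr (2 * p - 1)) * of_real (exp (- (s\<^sup>2 / 4) - t\<^sup>2 / 2 - s * t))))"
    by (auto simp: parabolic_kernel_def indicator_def)
  have [measurable]: "(\<lambda>t. indicator {0<..} t *\<^sub>R complex_of_real t powr (2 * p - 1)) \<in> borel_measurable borel"
    using m by (simp add: set_borel_measurable_def)
  have F: "case_prod ?F \<in> borel_measurable (lborel \<Otimes>\<^sub>M lborel)"
    unfolding eqF by measurable
  have bnd: "norm (?F t s) \<le> ?g t * ?h s" for t s
  proof (cases "t > 0 \<and> s > 0")
    case True
    then have "exp (- (s\<^sup>2 / 4) - t\<^sup>2 / 2 - s * t) \<le> exp (- (1/2) * t\<^sup>2) * exp (- (1/4) * s\<^sup>2)"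
      by (simp flip: exp_add)
    then show ?thesis using True
      by (simp add: parabolic_kernel_def norm_mult norm_of_real_powr mult_left_mono)
  qed auto
  have gh: "integrable (lborel \<Otimes>\<^sub>M lborel) (\<lambda>(t, s). ?g t * ?h s)"
    by (rule integrable_lborel_times[OF g h])
  show ?thesis
    by (rule Bochner_Integration.integrable_bound[OF gh F]) 
       (use bnd in \<open>auto intro!: AE_I2 elim!: order_trans simp: abs_ge_self\<close>)
qed

lemma powr_of_real_Suc: "0 < t \<Longrightarrow> complex_of_real t powr (z + 1) = of_real t powr z * of_real t"
  by (simp add: powr_add)

text \<open>After \<open>s = t * x\<close> the exponent is -t^2 times the quadratic in
  \<open>x\<close>, so the \<open>t\<close>-integral is a Gaussian Mellin integral and leaves a
  power of that quadratic.\<close>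

lemma parabolic_kernel_quadrant:
  assumes p: "Re p > 0"
  shows "(LINT s:{0<..}|lborel. LINT t:{0<..}|lborel. parabolic_kernel p t s) =
         Gamma (p + 1/2) / 2 * (LINT x:{0<..}|lborel. of_real (x\<^sup>2 / 4 + x + 1/2) powr (- (p + 1/2)))"
proof -
  let ?F = "\<lambda>t s. indicator {0<..} t *\<^sub>R indicator {0<..} s *\<^sub>R parabolic_kernel p t s"
  let ?q = "\<lambda>x::real. x\<^sup>2 / 4 + x + 1/2"
  have "(LINT s:{0<..}|lborel. LINT t:{0<..}|lborel. parabolic_kernel p t s) =
        (\<integral>s. (\<integral>t. ?F t s \<partial>lborel) \<partial>lborel)"
    unfolding set_lebesgue_integral_def 
    by (intro Bochner_Integration.integral_cong refl) (auto simp: indicator_def)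
  also have "\<dots> = (\<integral>x. (\<integral>t. \<bar>t\<bar> *\<^sub>R ?F t (t * x) \<partial>lborel) \<partial>lborel)"
    by (rule homogeneous_Fubini[OF integrable_parabolic_kernel[OF p]])
  also have "\<dots> = (LINT x:{0<..}|lborel. Gamma (p + 1/2) / 2 * of_real (?q x) powr (- (p + 1/2)))"
    unfolding set_lebesgue_integral_def
  proof (intro Bochner_Integration.integral_cong refl)
    fix x :: real
    show "(\<integral>t. \<bar>t\<bar> *\<^sub>R ?F t (t * x) \<partial>lborel) =
          indicator {0<..} x *\<^sub>R (Gamma (p + 1/2) / 2 * of_real (?q x) powr (- (p + 1/2)))"
    proof (cases "x > 0")
      case x: True
      then have q: "?q x > 0" by (simp add: add_pos_nonneg)
      \<comment> \<open>The Jacobian \<open>t\<close> raises the kernel exponent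
        \<open>2 * p - 1\<close> by one, so the Mellin parameter is
        \<open>c = 2 * p + 1\<close>.\<close>
      have eq: "\<bar>t\<bar> *\<^sub>R ?F t (t * x) =
            indicator {0<..} t *\<^sub>R (of_real t powr (2 * p + 1 - 1) * of_real (exp (- ?q x * t\<^sup>2)))" for t :: real
      proof (cases "t > 0")
        case True
        have "- ((t * x)\<^sup>2 / 4) - t\<^sup>2 / 2 - t * x * t = - ?q x * t\<^sup>2"
          by (simp add: power2_eq_square field_simps)
        moreover have "complex_of_real t powr (2 * p) = of_real t powr (2 * p - 1) * of_real t"
          using powr_of_real_Suc[OF True, of "2 * p - 1"] by simp
        ultimately show ?thesis using True x
          by (simp only: parabolic_kernel_def) (simp add: scaleR_conv_of_real)
      qed auto
      have "(\<integral>t. \<bar>t\<bar> *\<^sub>R ?F t (t * x) \<partial>lborel) = 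
            (LINT t:{0<..}|lborel. of_real t powr (2 * p + 1 - 1) * of_real (exp (- ?q x * t\<^sup>2)))"
        unfolding set_lebesgue_integral_def eq ..
      also have "\<dots> = of_real (?q x) powr (- ((2 * p + 1) / 2)) * Gamma ((2 * p + 1) / 2) / 2"
        by (rule Gaussian_Mellin(2)) (use p q in auto)
      finally show ?thesis using x by (simp add: add_divide_distrib)
    next
      case False
      then have "(\<lambda>t. \<bar>t\<bar> *\<^sub>R ?F t (t * x)) = (\<lambda>_. 0)"
        by (auto simp: indicator_def zero_less_mult_iff)
      with False show ?thesis by (simp only:) simp
    qed
  qed
  finally show ?thesis by simp
qed

section \<open>The incomplete Beta integral and its Gauss hypergeometric form\<close>

text \<open>For 0 < Re p < 1/2 this is the part over (0, 1) of the Beta integral on the half line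
  with parameters \<open>p\<close> and \<open>1/2 - p\<close>.\<close>

definition half_beta :: "complex \<Rightarrow> complex" where
  "half_beta p = (LINT u:{0<..<1}|lborel. of_real u powr (p - 1) * of_real (1 / sqrt (1 + u)))"

text \<open>On (0, 1) the factor \<open>exp (1 - u)\<close> is at least 1, so \<open>exp 1\<close>
  times the Gamma integrand is a majorant.\<close>

lemma set_integrable_powr_Ioo:
  assumes "c > 0"
  shows "set_integrable lborel {0<..<1} (\<lambda>u::real. u powr (c - 1))"
proof -
  have "set_integrable lborel {0<..} (\<lambda>t. of_real t powr (complex_of_real c - 1) * of_real (exp (- 1 * t)))"
    using assms by (intro Gamma_integral_scaled) auto
  then have "set_integrable lborel {0<..<1} (\<lambda>t. of_real t powr (complex_of_real c - 1) * of_real (exp (- 1 * t)))"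
    by (rule set_integrable_subset) auto
  then have 1: "set_integrable lborel {0<..<1} (\<lambda>t. exp 1 * norm (of_real t powr (complex_of_real c - 1) * of_real (exp (- 1 * t))))"
    by (intro set_integrable_mult_right set_integrable_norm) auto
  have "set_integrable lborel {0<..<1} (\<lambda>u. complex_of_real (u powr (c - 1)))"
  proof (rule set_integrable_dominated_by[OF 1])
    show "set_borel_measurable borel {0<..<1} (\<lambda>u. complex_of_real (u powr (c - 1)))"
      by (intro set_borel_measurable_continuous_open) (auto intro!: continuous_intros)
    fix u :: real assume u: "u \<in> {0<..<1}"
    have "u powr (c - 1) * 1 \<le> u powr (c - 1) * exp (1 - u)"
      using u by (intro mult_left_mono) auto
    then show "norm (complex_of_real (u powr (c - 1))) \<le> exp 1 * norm (of_real u powr (complex_of_real c - 1) * of_real (exp (- 1 * u)))"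
      using u by (simp add: norm_mult norm_divide norm_of_real_powr exp_diff exp_minus field_simps)
  qed
  from set_integrable_norm[OF this] show ?thesis by simp
qed

lemma half_beta_integrable:
  assumes "Re p > 0"
  shows "set_integrable lborel {0<..<1} (\<lambda>u. of_real u powr (p - 1) * of_real (1 / sqrt (1 + u)))"
proof (rule set_integrable_dominated_by[OF set_integrable_powr_Ioo[OF assms]])
  show "set_borel_measurable borel {0<..<1} (\<lambda>u. of_real u powr (p - 1) * complex_of_real (1 / sqrt (1 + u)))"
    by (intro set_borel_measurable_continuous_open) (auto intro!: continuous_intros)
  fix u :: real assume u: "u \<in> {0<..<1}"
  then have "u powr (Re p - 1) * (1 / sqrt (1 + u)) \<le> u powr (Re p - 1) * 1"
    by (intro mult_left_mono) auto
  then show "norm (of_real u powr (p - 1) * complex_of_real (1 / sqrt (1 + u))) \<le> u powr (Re p - 1)"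
    using u by (simp add: norm_mult norm_divide norm_of_real_powr)
qed

text \<open>The substitution is \<open>u = 1 / (2 q(x))\<close> with \<open>q(x) = x\<^sup>2/4 + x + 1/2\<close>, for which \<open>2 q(x) + 1\<close> is twice a square.\<close>

lemma quadratic_powr_integral:
  assumes p: "Re p > 0"
  shows "(LINT x:{0<..}|lborel. of_real (x\<^sup>2 / 4 + x + 1/2) powr (- (p + 1/2))) = 2 powr p * half_beta p"
proof -
  define q where "q x = x\<^sup>2 / 4 + x + 1/2" for x :: real
  let ?f = "\<lambda>u. of_real u powr (p - 1) * complex_of_real (1 / sqrt (1 + u))"
  let ?k = "\<lambda>x. 2 powr (- p) * of_real (q x) powr (- (p + 1/2))"
  let ?g = "\<lambda>x. 1 / (2 * q x)" and ?h = "\<lambda>x. - (x / 2 + 1) / (2 * (q x)\<^sup>2)"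
  have q: "q x > 1/2" if "x > 0" for x using that by (simp add: q_def add_pos_pos)
  have q': "q x > 0" "q x \<noteq> 0" if "x > 0" for x using q[OF that] by linarith+
  have qsq: "2 * q x + 1 = 2 * (x / 2 + 1)\<^sup>2" for x
    by (simp add: q_def power2_eq_square field_simps)
  have img: "?g ` {0<..} = {0<..<1}"
  proof (intro equalityI subsetI)
    fix u assume "u \<in> ?g ` {0<..}"
    then show "u \<in> {0<..<1}" using q q' by (force simp: field_simps)
  next
    fix u :: real assume u: "u \<in> {0<..<1}"
    \<comment> \<open>The positive solution of 2 (x/2 + 1)^2 = 1/u + 1, which by \<open>qsq\<close>
      amounts to \<open>u = 1 / (2 * q x)\<close>.\<close>
    let ?x = "2 * (sqrt ((1 / u + 1) / 2) - 1)"
    have "2 * (y - 1) / 2 + 1 = y" for y :: real by (simp add: field_simps)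
    then have sq: "?x / 2 + 1 = sqrt ((1 / u + 1) / 2)" .
    have "(1 / u + 1) / 2 > 1" using u by (simp add: field_simps)
    then have "sqrt ((1 / u + 1) / 2) > 1" by simp
    then have "?x > 0" by simp
    moreover have "2 * q ?x + 1 = 1 / u + 1"
      unfolding qsq sq using u by simp
    then have "2 * q ?x = 1 / u" by simp
    then have "u = ?g ?x" by (simp only:) simp
    ultimately show "u \<in> ?g ` {0<..}" by auto
  qed
  have inj: "inj_on ?g {0<..}"
  proof (rule inj_onI)
    fix x y :: real assume xy: "x \<in> {0<..}" "y \<in> {0<..}" "?g x = ?g y"
    then have "2 * q x + 1 = 2 * q y + 1" using q'[of x] q'[of y] by (simp add: field_simps)
    then have "(x / 2 + 1)\<^sup>2 = (y / 2 + 1)\<^sup>2" unfolding qsq by simp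
    then show "x = y" using xy by (simp add: power2_eq_iff_nonneg)
  qed
  have der: "(?g has_real_derivative ?h x) (at x within {0<..})" if "x \<in> {0<..}" for x
  proof -
    have "(q has_real_derivative (x / 2 + 1)) (at x within {0<..})"
      unfolding q_def by (auto intro!: derivative_eq_intros)
    then have "((\<lambda>x. 2 * q x) has_real_derivative 2 * (x / 2 + 1)) (at x within {0<..})"
      by (rule DERIV_cmult)
    moreover have "2 * q x \<noteq> 0" using q'[of x] that by simp
    ultimately have "(?g has_real_derivative (0 * (2 * q x) - 1 * (2 * (x / 2 + 1))) / ((2 * q x) * (2 * q x))) (at x within {0<..})"
      by (intro DERIV_divide DERIV_const)
    moreover have "(0 * (2 * r) - 1 * (2 * y)) / ((2 * r) * (2 * r)) = - y / (2 * r\<^sup>2)" for r y :: real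
      by (simp add: power2_eq_square)
    ultimately show ?thesis by metis
  qed
  have m1: "set_borel_measurable borel {0<..<1} ?f"
    by (intro set_borel_measurable_continuous_open) (auto intro!: continuous_intros)
  have m2: "set_borel_measurable borel {0<..} ?k"
  proof (intro set_borel_measurable_continuous_open continuous_on_mult_left continuous_on_of_real_powr)
    show "continuous_on {0<..} q" unfolding q_def by (intro continuous_intros) auto
  qed (use q' in auto)
  have eq: "?k x = \<bar>?h x\<bar> *\<^sub>R ?f (?g x)" if "x \<in> {0<..}" for x
  proof -
    have x: "x > 0" using that by simp
    define r where "r = q x"
    have r: "r > 0" using q'[OF x] by (simp add: r_def)
    \<comment> \<open>This square makes \<open>x / 2 + 1\<close> the only part of the root besides
      \<open>sqrt r\<close>; it cancels against the numerator of the derivative and leaves a pure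
      power of \<open>r\<close>.\<close>
    have "(x / 2 + 1)\<^sup>2 = r + 1/2"
      using qsq[of x] unfolding r_def by linarith
    then have "1 + ?g x = (x / 2 + 1)\<^sup>2 / r"
      using r by (simp add: r_def[symmetric] divide_simps)
    then have s: "1 / sqrt (1 + ?g x) = sqrt r / (x / 2 + 1)"
      using x by (simp add: real_sqrt_divide)
    have "complex_of_real (?g x) powr (p - 1) = of_real (2 * r) powr (1 - p)"
      using r unfolding r_def[symmetric]
      by (simp add: powr_of_real_eq_exp ln_div algebra_simps del: of_real_divide of_real_mult)
    also have "\<dots> = of_real 2 powr (1 - p) * of_real r powr (1 - p)"
      using r by (intro powr_of_real_mult) auto
    finally have a: "complex_of_real (?g x) powr (p - 1) = 2 powr (1 - p) * of_real r powr (1 - p)" by simp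
    have b: "complex_of_real (sqrt r) = of_real r powr (1/2)"
      using r powr_of_real[of r "1/2"] powr_half_sqrt[of r] by simp
    have "of_real r powr (- (p + 1/2)) = of_real r powr (1 - p) * complex_of_real r powr (1/2) * of_real r powr (-2)"
    proof -
      have e: "- (p + 1/2) = 1 - p + 1/2 + (-2)" by simp
      show ?thesis by (subst e) (simp only: powr_add)
    qed
    also have "complex_of_real r powr (-2) = 1 / (of_real r)\<^sup>2"
      using r by (simp add: powr_minus_divide powr_numeral)
    finally have c: "of_real r powr (- (p + 1/2)) = of_real r powr (1 - p) * complex_of_real (sqrt r) / (of_real r)\<^sup>2"
      unfolding b by simp
    have d: "(2::complex) powr (1 - p) = 2 * 2 powr (- p)"
      by (simp add: powr_diff powr_minus_divide)
    have e: "\<bar>?h x\<bar> = (x / 2 + 1) / (2 * r\<^sup>2)" using x by (simp add: r_def)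
    have "complex_of_real x / 2 + 1 = of_real (x / 2 + 1)" by simp
    also have "\<dots> \<noteq> 0" using x unfolding of_real_eq_0_iff by linarith
    finally have nz: "complex_of_real x / 2 + 1 \<noteq> 0" .
    show ?thesis
      unfolding s[folded r_def] a[folded r_def] e[folded r_def] r_def[symmetric] c d scaleR_conv_of_real using r nz
      by (simp add: divide_simps)
  qed
  have "2 powr (- p) * (LINT x:{0<..}|lborel. of_real (q x) powr (- (p + 1/2))) = half_beta p"
    using set_lebesgue_integral_substitution(2)[of "{0<..}" ?g ?h ?f ?k, OF _ der inj _ m2 eq] m1
    unfolding img half_beta_def by simp
  then show ?thesis
    unfolding q_def by (simp add: powr_minus field_simps)
qed

section \<open>The complete Beta integral and the reflection of \<open>half_beta\<close>\<close>

lemma set_integral_split_at_1: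
  fixes f :: "real \<Rightarrow> complex"
  assumes "set_borel_measurable borel {0<..} f"
    and "set_integrable lborel {0<..<1} f" "set_integrable lborel {1<..} f"
  shows "(LINT x:{0<..}|lborel. f x) = (LINT x:{0<..<1}|lborel. f x) + (LINT x:{1<..}|lborel. f x)"
proof -
  have un: "(LINT x:{0<..<1} \<union> {1<..}|lborel. f x) = (LINT x:{0<..<1}|lborel. f x) + (LINT x:{1<..}|lborel. f x)"
    by (rule set_integral_Un) (use assms in auto)
  have "set_integrable lborel ({0<..<1} \<union> {1<..}) f"
    by (rule set_integrable_Un) (use assms in auto)
  then have "(\<lambda>x. indicator ({0<..<1} \<union> {1<..}) x *\<^sub>R f x) \<in> borel_measurable lborel"
    unfolding set_integrable_def by (rule borel_measurable_integrable)
  moreover have "AE x in lborel. x \<noteq> (1::real)" by (rule AE_lborel_singleton)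
  then have "AE x in lborel. indicator ({0<..<1} \<union> {1<..}) x *\<^sub>R f x = indicator {0<..} x *\<^sub>R f x"
    by eventually_elim (auto simp: indicator_def)
  ultimately have "(LINT x:{0<..<1} \<union> {1<..}|lborel. f x) = (LINT x:{0<..}|lborel. f x)"
    unfolding set_lebesgue_integral_def
    using assms(1)[unfolded set_borel_measurable_def] by (intro integral_cong_AE) simp_all
  with un show ?thesis by simp
qed

text \<open>The product of two Gamma integrals is a double integral over the quadrant; the shear
  \<open>s = t * x\<close> turns its \<open>t\<close>-integral into a Gamma integral with rate
  \<open>1 + x\<close>. The result is the Beta integral on the half line.\<close>

lemma Gamma_product_integral:
  assumes p: "Re p > 0" and q: "Re q > 0"
  shows "Gamma p * Gamma q =
    Gamma (p + q) * (LINT x:{0<..}|lborel. of_real x powr (p - 1) * of_real (1 + x) powr (- (p + q)))"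
proof -
  let ?f = "\<lambda>s::real. of_real s powr (p - 1) * complex_of_real (exp (- 1 * s))"
  let ?g = "\<lambda>t::real. of_real t powr (q - 1) * complex_of_real (exp (- 1 * t))"
  let ?F = "\<lambda>t s. (indicator {0<..} t *\<^sub>R ?g t) * (indicator {0<..} s *\<^sub>R ?f s)"
  note f = Gamma_integral_scaled[OF p, of 1] and g = Gamma_integral_scaled[OF q, of 1]
  have int: "integrable (lborel \<Otimes>\<^sub>M lborel) (case_prod ?F)"
    using f(1) g(1) unfolding set_integrable_def by (intro integrable_lborel_times) auto
  have "Gamma p * Gamma q = (LINT t:{0<..}|lborel. ?g t) * (LINT s:{0<..}|lborel. ?f s)"
    using f(2) g(2) by simp
  also have "\<dots> = (\<integral>s. (\<integral>t. ?F t s \<partial>lborel) \<partial>lborel)"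
    unfolding set_lebesgue_integral_def by (simp only: integral_mult_left_zero integral_mult_right_zero)
  also have "\<dots> = (\<integral>x. (\<integral>t. \<bar>t\<bar> *\<^sub>R ?F t (t * x) \<partial>lborel) \<partial>lborel)"
    by (rule homogeneous_Fubini[OF int])
  also have "\<dots> = (LINT x:{0<..}|lborel. Gamma (p + q) * (of_real x powr (p - 1) * of_real (1 + x) powr (- (p + q))))"
    unfolding set_lebesgue_integral_def
  proof (intro Bochner_Integration.integral_cong refl)
    fix x :: real
    show "(\<integral>t. \<bar>t\<bar> *\<^sub>R ?F t (t * x) \<partial>lborel) =
       indicator {0<..} x *\<^sub>R (Gamma (p + q) * (of_real x powr (p - 1) * of_real (1 + x) powr (- (p + q))))"
    proof (cases "x > 0")
      case x: True
      let ?h = "\<lambda>t. of_real t powr (p + q - 1) * complex_of_real (exp (- (1 + x) * t))"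
      have eq: "\<bar>t\<bar> *\<^sub>R ?F t (t * x) = of_real x powr (p - 1) * (indicator {0<..} t *\<^sub>R ?h t)" for t
      proof (cases "t > 0")
        case True
        \<comment> \<open>The last factor \<open>t\<close> is the Jacobian of the shear.\<close>
        have "complex_of_real t powr (p + q - 1) = of_real t powr (q - 1) * of_real t powr (p - 1) * of_real t"
          using powr_of_real_Suc[OF True, of "q - 1 + (p - 1)"] 
          by (simp only: powr_add[symmetric]) (simp add: algebra_simps)
        moreover have "exp (- (1 + x) * t) = exp (- 1 * t) * exp (- 1 * (t * x))"
          by (simp add: algebra_simps flip: exp_add)
        ultimately show ?thesis using True x
          by (simp only: powr_of_real_mult) (simp add: scaleR_conv_of_real)
      qed auto
      have "(\<integral>t. \<bar>t\<bar> *\<^sub>R ?F t (t * x) \<partial>lborel) = of_real x powr (p - 1) * (LINT t:{0<..}|lborel. ?h t)"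
        unfolding set_lebesgue_integral_def eq by (rule integral_mult_right_zero)
      also have "(LINT t:{0<..}|lborel. ?h t) = of_real (1 + x) powr (- (p + q)) * Gamma (p + q)"
        by (rule Gamma_integral_scaled(2)) (use p q x in auto)
      finally show ?thesis using x by simp
    next
      case False
      then have "(\<lambda>t. \<bar>t\<bar> *\<^sub>R ?F t (t * x)) = (\<lambda>_. 0)"
        by (auto simp: indicator_def zero_less_mult_iff)
      with False show ?thesis by (simp only:) simp
    qed
  qed
  finally show ?thesis by simp
qed

lemma powr_minus_half_of_real: "0 < x \<Longrightarrow> complex_of_real x powr (- (1/2)) = of_real (1 / sqrt x)"
proof -
  assume x: "0 < x"
  have "complex_of_real x powr of_real (- (1/2)) = of_real (x powr (- (1/2)))"
    using x by (intro powr_of_real) auto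
  then show ?thesis using x by (simp add: powr_minus powr_half_sqrt inverse_eq_divide)
qed

text \<open>The substitution \<open>u \<mapsto> 1/u\<close> sends \<open>H(1/2 - p)\<close> to the part of the complete Beta integral over \<open>(1, \<infinity>)\<close>.\<close>

lemma half_beta_reflection:
  assumes p: "0 < Re p" "Re p < 1/2"
  shows "half_beta p + half_beta (1/2 - p) = Gamma p * Gamma (1/2 - p) / of_real (sqrt pi)"
proof -
  let ?k = "\<lambda>x. of_real x powr (p - 1) * complex_of_real (1 / sqrt (1 + x))"
  let ?f = "\<lambda>u. of_real u powr (1/2 - p - 1) * complex_of_real (1 / sqrt (1 + u))"
  have img: "(\<lambda>x. 1 / x) ` {1<..} = {0<..<1::real}"
  proof (intro equalityI subsetI)
    fix u :: real assume "u \<in> {0<..<1}"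
    then show "u \<in> (\<lambda>x. 1 / x) ` {1<..}" by (intro image_eqI[of _ _ "1 / u"]) (auto simp: field_simps)
  qed (auto simp: field_simps)
  have der: "((\<lambda>x. 1 / x) has_real_derivative (- 1 / x\<^sup>2)) (at x within {1<..})" if "x \<in> {1<..}" for x :: real
    using that by (auto intro!: derivative_eq_intros simp: power2_eq_square)
  have inj: "inj_on (\<lambda>x. 1 / x) {1::real<..}" by (auto simp: inj_on_def)
  have m1: "set_borel_measurable borel {0<..<1} ?f"
    by (intro set_borel_measurable_continuous_open) (auto intro!: continuous_intros)
  have m2: "set_borel_measurable borel {1<..} ?k"
    by (intro set_borel_measurable_continuous_open) (auto intro!: continuous_intros)
  have eq: "?k x = \<bar>- 1 / x\<^sup>2\<bar> *\<^sub>R ?f (1 / x)" if "x \<in> {1<..}" for x :: real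
  proof -
    have x: "x > 1" using that by simp
    have "1 + 1 / x = (1 + x) / x" using x by (simp add: field_simps)
    then have s: "1 / sqrt (1 + 1 / x) = sqrt x / sqrt (1 + x)" by (simp add: real_sqrt_divide)
    have a: "complex_of_real (1 / x) powr (1/2 - p - 1) = of_real x powr (p + 1/2)"
      using x by (simp add: powr_of_real_eq_exp ln_div algebra_simps add_divide_distrib del: of_real_divide)
    have b: "complex_of_real (1 / sqrt x) = of_real x powr (- (1/2))"
      using x by (simp add: powr_minus_half_of_real)
    have "complex_of_real x powr (p + 1/2) = of_real x powr (p - 1) * (of_real x powr (- (1/2)) * (of_real x powr 2))"
    proof -
      have e: "p + 1/2 = (p - 1) + (- (1/2) + 2)" by simp
      show ?thesis by (subst e) (simp only: powr_add)
    qed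
    also have "complex_of_real x powr 2 = (of_real x)\<^sup>2"
      using x by (simp add: powr_numeral)
    also have "of_real x powr (- (1/2)) * (complex_of_real x)\<^sup>2 = of_real ((1 / sqrt x) * x\<^sup>2)"
      unfolding b[symmetric] by simp
    also have "(1 / sqrt x) * x\<^sup>2 * sqrt x = x\<^sup>2" using x by simp
    then have "(1 / sqrt x) * x\<^sup>2 = x\<^sup>2 / sqrt x" by simp
    finally have c: "complex_of_real x powr (p + 1/2) = of_real x powr (p - 1) * of_real (x\<^sup>2 / sqrt x)" .
    show ?thesis
      unfolding s a c scaleR_conv_of_real using x by (simp add: field_simps)
  qed
  have half: "Re (1/2 - p) > 0" using p by simp
  have I: "set_integrable lborel {1<..} ?k" "(LINT x:{1<..}|lborel. ?k x) = half_beta (1/2 - p)"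
    using set_lebesgue_integral_substitution[of "{1<..}" "\<lambda>x. 1 / x" "\<lambda>x. - 1 / x\<^sup>2" ?f ?k, OF _ der inj _ m2 eq]
      m1 half_beta_integrable[OF half]
    unfolding img half_beta_def by auto
  have "half_beta p + half_beta (1/2 - p) = (LINT x:{0<..}|lborel. ?k x)"
    unfolding I(2)[symmetric] half_beta_def[of p]
    by (rule set_integral_split_at_1[symmetric])
      (use I(1) half_beta_integrable p in \<open>auto intro!: set_borel_measurable_continuous_open continuous_intros\<close>)
  \<comment> \<open>The exponent sum \<open>p + (1/2 - p)\<close> is 1/2, which identifies the
    inverse square root with the weight in \<open>Gamma_product_integral\<close>.\<close>
  also have "\<dots> = (LINT x:{0<..}|lborel. of_real x powr (p - 1) * of_real (1 + x) powr (- (p + (1/2 - p))))"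
    by (intro set_lebesgue_integral_cong) (auto simp: powr_minus_half_of_real simp del: of_real_add)
  finally have "half_beta p + half_beta (1/2 - p) = \<dots>" .
  moreover have "Gamma p * Gamma (1/2 - p) = Gamma (1/2) * \<dots>"
    using Gamma_product_integral[OF p(1) half] by simp
  ultimately show ?thesis by (simp add: Gamma_one_half_complex)
qed

text \<open>A Beta integral with an integer parameter, by induction on \<open>n\<close>: (1 -
  v)^(n+1) = (1 - v)^n - v (1 - v)^n, where the factor \<open>v\<close> shifts \<open>p\<close> to
  \<open>p + 1\<close>. Hence the induction leaves \<open>p\<close> arbitrary.\<close>

lemma integral_powr_times_power:
  assumes "Re p > 0"
  shows "set_integrable lborel {0<..<1} (\<lambda>v. of_real v powr (p - 1) * of_real ((1 - v) ^ n)) \<and>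
    (LINT v:{0<..<1}|lborel. of_real v powr (p - 1) * of_real ((1 - v) ^ n)) = fact n / pochhammer p (Suc n)"
  using assms
proof (induction n arbitrary: p)
  case 0
  have I: "set_integrable lborel {0<..<1} (\<lambda>v. complex_of_real v powr (p - 1))"
    by (rule set_integrable_dominated_by[OF set_integrable_powr_Ioo[OF 0]], intro set_borel_measurable_continuous_open)
      (auto intro!: continuous_intros simp: norm_of_real_powr)
  \<comment> \<open>The primitive v^p / p extends continuously to 0 because Re p > 0, while
    differentiability is used only in the interior.\<close>
  have "((\<lambda>v. complex_of_real v powr (p - 1)) has_integral of_real 1 powr p / p - of_real 0 powr p / p) {0..1}"
  proof (rule fundamental_theorem_of_calculus_interior)
    show "continuous_on {0..1} (\<lambda>v. complex_of_real v powr p / p)"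
      using 0 by (intro continuous_intros continuous_on_powr_complex) auto
    fix x :: real assume x: "x \<in> {0<..<1}"
    have "((\<lambda>v. complex_of_real v powr p / p) has_vector_derivative (1 * (p * of_real x powr (p - 1) / p))) (at x)"
      using x 0 by (intro field_vector_diff_chain_at[where f = of_real and g = "\<lambda>z. z powr p / p", unfolded o_def])
         (auto intro!: derivative_eq_intros simp: has_vector_derivative_of_real)
    then show "((\<lambda>v. complex_of_real v powr p / p) has_vector_derivative (of_real x powr (p - 1))) (at x)"
      using 0 by (cases "p = 0") auto
  qed auto
  then have "((\<lambda>v. complex_of_real v powr (p - 1)) has_integral 1 / p) {0<..<1}"
    using 0 by (simp add: has_integral_Icc_iff_Ioo)
  then show ?case using I set_borel_integral_eq_integral(2)[OF I] by (simp add: integral_unique)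
next
  case (Suc n)
  have p1: "Re (p + 1) > 0" using Suc.prems by simp
  note I1 = Suc.IH[OF Suc.prems] and I2 = Suc.IH[OF p1]
  let ?f1 = "\<lambda>v. of_real v powr (p - 1) * complex_of_real ((1 - v) ^ n)"
  let ?f2 = "\<lambda>v. of_real v powr (p + 1 - 1) * complex_of_real ((1 - v) ^ n)"
  let ?f = "\<lambda>v. of_real v powr (p - 1) * complex_of_real ((1 - v) ^ Suc n)"
  have eq: "?f v = ?f1 v - ?f2 v" if "v \<in> {0<..<1}" for v
    using powr_of_real_Suc[of v "p - 1"] that by (simp add: algebra_simps)
  have i: "set_integrable lborel {0<..<1} (\<lambda>v. ?f1 v - ?f2 v)"
    using I1 I2 by (intro set_integral_diff) auto
  have "(LINT v:{0<..<1}|lborel. ?f v) = (LINT v:{0<..<1}|lborel. ?f1 v - ?f2 v)"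
    by (intro set_lebesgue_integral_cong) (use eq in auto)
  also have "\<dots> = fact n / pochhammer p (Suc n) - fact n / pochhammer (p + 1) (Suc n)"
    using I1 I2 by (subst set_integral_diff) auto
  also have "\<dots> = fact (Suc n) / pochhammer p (Suc (Suc n))"
  proof -
    have nz: "p \<noteq> 0" "p + of_nat (Suc n) \<noteq> 0" "pochhammer (p + 1) n \<noteq> 0"
    proof -
      show "p \<noteq> 0" using Suc.prems by auto
      have "Re (p + of_nat (Suc n)) > 0" using Suc.prems by simp
      then show "p + of_nat (Suc n) \<noteq> 0" by (metis less_irrefl zero_complex.sel(1))
      show "pochhammer (p + 1) n \<noteq> 0" by (rule pochhammer_nonzero[OF p1])
    qed
    have "pochhammer p (Suc n) = p * pochhammer (p + 1) n"
      by (simp add: pochhammer_rec)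
    moreover have "pochhammer (p + 1) (Suc n) = pochhammer (p + 1) n * (p + of_nat (Suc n))"
      by (simp add: pochhammer_Suc algebra_simps)
    moreover have "pochhammer p (Suc (Suc n)) = p * (pochhammer (p + 1) n * (p + of_nat (Suc n)))"
      by (subst pochhammer_rec) (simp add: pochhammer_Suc algebra_simps)
    \<comment> \<open>The two induction values share all factors but the first and the last, so
      their difference is this partial fraction identity.\<close>
    moreover have "1 / (p * P) - 1 / (P * (p + of_nat (Suc n))) = of_nat (Suc n) / (p * (P * (p + of_nat (Suc n))))"
      if "P \<noteq> 0" for P using nz(1,2) that by (simp add: divide_simps)
    from arg_cong[OF this[OF nz(3)], of "\<lambda>x. fact n * x"]
    have "fact n / (p * pochhammer (p + 1) n) - fact n / (pochhammer (p + 1) n * (p + of_nat (Suc n))) =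
      fact (Suc n) / (p * (pochhammer (p + 1) n * (p + of_nat (Suc n))))"
      by (simp only: right_diff_distrib times_divide_eq_right mult_1_right fact_Suc) (simp add: mult.commute)
    ultimately show ?thesis by (simp only:)
  qed
  finally have "(LINT v:{0<..<1}|lborel. ?f v) = fact (Suc n) / pochhammer p (Suc (Suc n))" .
  moreover have "set_integrable lborel {0<..<1} ?f = set_integrable lborel {0<..<1} (\<lambda>v. ?f1 v - ?f2 v)"
    by (intro set_integrable_cong refl eq)
  ultimately show ?case using i by simp
qed

text \<open>Since 1 + v = 2 (1 - (1 - v)/2), the binomial series expands sqrt 2 / sqrt (1 + v) in
  powers of 1 - v. Termwise integration against v^(p-1) gives Pochhammer symbols at
  \<open>p\<close>; splitting off their first factor shifts the parameter to \<open>p + 1\<close>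
  and yields the factor \<open>p\<close>.\<close>

lemma gaussF_eq_half_beta:
  assumes p: "Re p > 0"
  shows "gaussF (1/2) 1 (p + 1) (1/2) = p * of_real (sqrt 2) * half_beta p"
proof -
  define c :: "nat \<Rightarrow> real" where "c n = pochhammer (1/2) n / fact n * (1/2) ^ n" for n :: nat
  let ?term = "\<lambda>n v. of_real v powr (p - 1) * complex_of_real ((1 - v) ^ n)"
  let ?lim = "\<lambda>v. of_real v powr (p - 1) * complex_of_real (sqrt 2 / sqrt (1 + v))"
  have c0: "0 \<le> c n" for n by (simp add: c_def pochhammer_nonneg)
  \<comment> \<open>This geometric bound keeps all partial sums on (0, 1) below 2, the constant in
    the majorant used later.\<close>
  have c1: "c n \<le> (1/2) ^ n" for n
  proof -
    have "pochhammer (1/2 :: real) n \<le> pochhammer 1 n"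
      unfolding pochhammer_prod by (intro prod_mono) auto
    then show ?thesis by (simp add: c_def pochhammer_fact[symmetric] divide_simps)
  qed
  have sums: "(\<lambda>n. c n * (1 - v) ^ n) sums (sqrt 2 / sqrt (1 + v))" if v: "v \<in> {0<..<1}" for v :: real
  proof -
    have "(\<lambda>n. (-1/2 gchoose n) * (- (1 - v) / 2) ^ n) sums (1 + (- (1 - v) / 2)) powr (-1/2)"
      using v by (intro gen_binomial_real) auto
    also have "(\<lambda>n. (-1/2 gchoose n) * (- (1 - v) / 2) ^ n) = (\<lambda>n. c n * (1 - v) ^ n)"
    proof
      fix n
      have "(- (1 - v) / 2) ^ n = (-1) ^ n * ((1/2) ^ n * (1 - v) ^ n)"
        by (simp flip: power_mult_distrib)
      then show "(-1/2 gchoose n) * (- (1 - v) / 2) ^ n = c n * (1 - v) ^ n"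
        by (simp only: gbinomial_pochhammer c_def) (simp flip: power_add)
    qed
    also have "1 + (- (1 - v) / 2) = (1 + v) / 2" by (simp add: field_simps)
    also have "((1 + v) / 2) powr (-1/2) = sqrt 2 / sqrt (1 + v)"
      using v powr_minus[of "(1 + v) / 2" "1/2"] by (simp add: powr_half_sqrt real_sqrt_divide)
    finally show ?thesis .
  qed
  have int_term: "set_integrable lborel {0<..<1} (\<lambda>v. complex_of_real (c n) * ?term n v)" for n
    using integral_powr_times_power[OF p, of n] by (intro set_integrable_mult_right) auto
  have half: "pochhammer (1/2 :: complex) n = of_real (pochhammer (1/2) n)" for n
    by (simp flip: pochhammer_of_real)
  have "p \<noteq> 0" using p by auto
  have int: "(LINT v:{0<..<1}|lborel. complex_of_real (c n) * ?term n v) =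
      pochhammer (1/2) n * pochhammer 1 n / (pochhammer (p + 1) n * fact n) * (1/2) ^ n / p" for n
  proof -
    have "(LINT v:{0<..<1}|lborel. complex_of_real (c n) * ?term n v) = of_real (c n) * (fact n / pochhammer p (Suc n))"
      using integral_powr_times_power[OF p, of n] by (subst set_integral_mult_right) (simp only:)
    then show ?thesis
      unfolding c_def half pochhammer_rec[of p] pochhammer_fact[symmetric] using \<open>p \<noteq> 0\<close> by simp
  qed
  have "(\<lambda>n. LINT v:{0<..<1}|lborel. complex_of_real (c n) * ?term n v) sums (LINT v:{0<..<1}|lborel. ?lim v)"
  proof (rule set_integral_sums_dominated)
    show "set_integrable lborel {0<..<1} (\<lambda>v. 2 * v powr (Re p - 1))"
      using set_integrable_powr_Ioo[OF p] by (intro set_integrable_mult_right) auto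
    show "set_borel_measurable borel {0<..<1} ?lim"
      by (intro set_borel_measurable_continuous_open) (auto intro!: continuous_intros)
    fix v :: real assume v: "v \<in> {0<..<1}"
    have psum: "complex_of_real (c n) * ?term n v = of_real v powr (p - 1) * of_real (c n * (1 - v) ^ n)" for n
      by simp
    show "(\<lambda>n. complex_of_real (c n) * ?term n v) sums ?lim v"
      unfolding psum using sums[OF v] by (intro sums_mult sums_of_real)
    fix N
    have "(\<Sum>n<N. c n * (1 - v) ^ n) \<le> (\<Sum>n<N. (1/2) ^ n * 1)"
      using v c0 by (intro sum_mono mult_mono c1 power_le_one) auto
    also have "\<dots> = (\<Sum>n<N. (1/2) ^ n)" by simp
    also have "\<dots> \<le> (\<Sum>n. (1/2) ^ n)"
      by (intro sum_le_suminf summable_geometric) auto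
    also have "\<dots> = 2" by (simp add: suminf_geometric)
    finally have le: "(\<Sum>n<N. c n * (1 - v) ^ n) \<le> 2" .
    have "0 \<le> (\<Sum>n<N. c n * (1 - v) ^ n)"
      using v c0 by (intro sum_nonneg mult_nonneg_nonneg) auto
    with le have "v powr (Re p - 1) * \<bar>\<Sum>n<N. c n * (1 - v) ^ n\<bar> \<le> v powr (Re p - 1) * 2"
      by (intro mult_left_mono) auto
    moreover have "(\<Sum>n<N. complex_of_real (c n) * ?term n v) = of_real v powr (p - 1) * of_real (\<Sum>n<N. c n * (1 - v) ^ n)"
      unfolding psum by (simp only: of_real_sum sum_distrib_left)
    ultimately show "norm (\<Sum>n<N. complex_of_real (c n) * ?term n v) \<le> 2 * v powr (Re p - 1)"
      using v by (simp add: norm_mult norm_of_real_powr mult.commute del: of_real_sum)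
  qed (rule int_term)
  also have "(LINT v:{0<..<1}|lborel. ?lim v) = (LINT v:{0<..<1}|lborel. of_real (sqrt 2) * (of_real v powr (p - 1) * of_real (1 / sqrt (1 + v))))"
    by (intro set_lebesgue_integral_cong) auto
  also have "\<dots> = of_real (sqrt 2) * half_beta p"
    unfolding half_beta_def by (rule set_integral_mult_right)
  finally have "(\<lambda>n. p * (pochhammer (1/2) n * pochhammer 1 n / (pochhammer (p + 1) n * fact n) * (1/2) ^ n / p))
      sums (p * (of_real (sqrt 2) * half_beta p))"
    unfolding int by (rule sums_mult)
  then show ?thesis
    unfolding gaussF_def using \<open>p \<noteq> 0\<close> by (simp add: sums_iff mult_ac)
qed

section \<open>Kummer's function and the integral representation of U\<close>

text \<open>These are the quotients of successive Kummer terms. Writing (a + n)/(b + n) as 1 + (a -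
  b)/(b + n), valid once \<open>b + n\<close> is nonzero, exposes the decay 1/(n + 1).\<close>

lemma kummer_ratio_tendsto_0:
  fixes a b z :: complex
  shows "(\<lambda>n. (a + of_nat n) / ((b + of_nat n) * of_nat (Suc n)) * z) \<longlonglongrightarrow> 0"
proof -
  have inf: "filterlim (\<lambda>n. b + of_nat n :: complex) at_infinity sequentially"
    by (rule tendsto_add_filterlim_at_infinity[OF tendsto_const tendsto_of_nat])
  have "(\<lambda>n. (1 + (a - b) * inverse (b + of_nat n)) * (inverse (of_nat (Suc n)) * z)) \<longlonglongrightarrow> (1 + (a - b) * 0) * (0 * z)"
    by (intro tendsto_intros tendsto_inverse_0_at_top filterlim_compose[OF tendsto_inverse_0 inf]
        LIMSEQ_Suc[OF filterlim_compose[OF tendsto_inverse_0 tendsto_of_nat]])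
  moreover have "eventually (\<lambda>n. b + of_nat n \<noteq> 0) sequentially"
    using inf by (metis (mono_tags) eventually_mono filterlim_at_infinity_imp_eventually_ne)
  then have "eventually (\<lambda>n. (1 + (a - b) * inverse (b + of_nat n)) * (inverse (of_nat (Suc n)) * z) =
      (a + of_nat n) / ((b + of_nat n) * of_nat (Suc n)) * z) sequentially"
    by eventually_elim (simp add: divide_simps del: of_nat_Suc)
  ultimately show ?thesis
    using Lim_transform_eventually by fastforce
qed

lemma kummerM_summable:
  fixes a b z :: complex
  shows "summable (\<lambda>n. norm (pochhammer a n / (pochhammer b n * fact n) * z ^ n))"
proof -
  let ?f = "\<lambda>n. pochhammer a n / (pochhammer b n * fact n) * z ^ n"
  have "eventually (\<lambda>n. norm ((a + of_nat n) / ((b + of_nat n) * of_nat (Suc n)) * z) < 1/2) sequentially"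
    using tendstoD[OF kummer_ratio_tendsto_0[of a b z], of "1/2"] by (simp add: dist_norm)
  then obtain N where N: "\<And>n. n \<ge> N \<Longrightarrow> norm ((a + of_nat n) / ((b + of_nat n) * of_nat (Suc n)) * z) < 1/2"
    by (auto simp: eventually_sequentially)
  show ?thesis
  proof (rule summable_ratio_test[of "1/2" N])
    fix n assume n: "N \<le> n"
    \<comment> \<open>The recursion also holds when \<open>b + n\<close> vanishes: both sides are
      then 0 by the convention for division by zero.\<close>
    have "?f (Suc n) = ((a + of_nat n) / ((b + of_nat n) * of_nat (Suc n)) * z) * ?f n"
      by (simp add: pochhammer_Suc divide_simps del: of_nat_Suc)
    then have "norm (?f (Suc n)) = norm ((a + of_nat n) / ((b + of_nat n) * of_nat (Suc n)) * z) * norm (?f n)"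
      by (simp only: norm_mult)
    also have "\<dots> \<le> 1/2 * norm (?f n)"
      by (intro mult_right_mono less_imp_le N n norm_ge_zero)
    finally show "norm (norm (?f (Suc n))) \<le> 1/2 * norm (norm (?f n))" by simp
  qed simp
qed

lemma kummerM_sums:
  "(\<lambda>n. pochhammer a n / (pochhammer b n * fact n) * z ^ n) sums kummerM a b z"
  unfolding kummerM_def using kummerM_summable by (rule summable_sums[OF summable_norm_cancel])

lemma kummerM_holomorphic: "kummerM a b holomorphic_on UNIV"
proof -
  let ?F = "Abs_fps (\<lambda>n. pochhammer a n / (pochhammer b n * fact n) :: complex)"
  have "summable (\<lambda>n. fps_nth ?F n * z ^ n)" for z
    using kummerM_sums[of a b z] by (simp add: sums_iff)
  then have "fps_conv_radius ?F = \<infinity>"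
    unfolding fps_conv_radius_def by (rule conv_radius_inftyI'')
  then have "eval_fps ?F holomorphic_on UNIV"
    by (intro holomorphic_on_eval_fps) auto
  also have "eval_fps ?F = kummerM a b"
    by (rule ext) (simp add: eval_fps_def kummerM_def)
  finally show ?thesis .
qed

text \<open>In the Cauchy product of the series of exp z and of M(b - a, b, -z), each coefficient is
  a Chu-Vandermonde sum.\<close>

lemma kummer_transformation:
  fixes a b z :: complex
  assumes b: "\<And>n. b \<noteq> - of_nat n"
  shows "kummerM a b z = exp z * kummerM (b - a) b (- z)"
proof -
  let ?u = "\<lambda>k. pochhammer (b - a) k / (pochhammer b k * fact k) * (- z) ^ k"
  let ?v = "\<lambda>k. z ^ k /\<^sub>R fact k"
  have "(\<lambda>n. \<Sum>i\<le>n. ?u i * ?v (n - i)) sums ((\<Sum>k. ?u k) * (\<Sum>k. ?v k))"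
    by (rule Cauchy_product_sums[OF kummerM_summable summable_norm_exp])
  also have "(\<lambda>n. \<Sum>i\<le>n. ?u i * ?v (n - i)) = (\<lambda>n. pochhammer a n / (pochhammer b n * fact n) * z ^ n)"
  proof
    fix n
    have coeff: "?u i * ?v (n - i) = z ^ n / fact n * ((pochhammer (b - a) i * pochhammer (- of_nat n) i) / (of_nat (fact i) * pochhammer b i))"
      if "i \<le> n" for i
    proof -
      \<comment> \<open>Turns the factorial from the exponential series into the terminating
        Pochhammer symbol of the Vandermonde sum; its sign cancels the one in (-z)^i.\<close>
      have "pochhammer (- of_nat n :: complex) i = (- 1) ^ i * (fact n / fact (n - i))"
      proof -
        have "(- 1) ^ i * pochhammer (- of_nat n :: complex) i / fact i = fact n / (fact i * fact (n - i))"
          using that by (simp flip: gbinomial_pochhammer binomial_gbinomial) (simp add: binomial_fact)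
        then have "(- 1) ^ i * pochhammer (- of_nat n :: complex) i = fact n / fact (n - i)"
          by (simp add: field_simps)
        moreover have "(- 1) ^ i * (- 1) ^ i = (1 :: complex)" by (simp flip: power_mult_distrib)
        ultimately show ?thesis by (metis mult.assoc mult_1)
      qed
      then show ?thesis
        using that by (simp add: power_minus[of z] scaleR_conv_of_real divide_simps flip: power_add)
    qed
    have "(\<Sum>i\<le>n. ?u i * ?v (n - i)) = z ^ n / fact n * (\<Sum>i=0..n. (pochhammer (b - a) i * pochhammer (- of_nat n) i) / (of_nat (fact i) * pochhammer b i))"
      unfolding sum_distrib_left atMost_atLeast0 by (rule sum.cong) (use coeff in auto)
    also have "\<dots> = z ^ n / fact n * (pochhammer a n / pochhammer b n)"
      using b by (subst Vandermonde_pochhammer) auto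
    finally show "(\<Sum>i\<le>n. ?u i * ?v (n - i)) = pochhammer a n / (pochhammer b n * fact n) * z ^ n"
      by (simp add: mult_ac)
  qed
  finally show ?thesis
    unfolding kummerM_def exp_def by (simp add: sums_iff mult.commute)
qed

text \<open>The partial sums of exp(-s t) are bounded by exp(|s| t). Completing a square absorbs
  this growth into half of the Gaussian exponent, with an integrable Gaussian left over.\<close>

lemma exp_kernel_dominated:
  fixes s t :: real
  assumes "t > 0"
  shows "exp (\<bar>s\<bar> * t) * exp (- (1/2) * t\<^sup>2) \<le> exp (s\<^sup>2) * exp (- (1/4) * t\<^sup>2)"
proof -
  have "0 \<le> (\<bar>s\<bar> - t / 2)\<^sup>2" by simp
  also have "\<dots> = s\<^sup>2 - \<bar>s\<bar> * t + t\<^sup>2 / 4"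
    by (simp add: power2_eq_square algebra_simps)
  finally show ?thesis by (simp flip: exp_add)
qed

text \<open>Expand exp(-s t) in powers of \<open>s\<close> and integrate termwise; the term of index
  \<open>n\<close> is a Gaussian Mellin integral with \<open>c = 2 * p + n\<close>. The factor
  exp(s^2/4) removes the part of the kernel that is free of \<open>t\<close>.\<close>

lemma parabolic_kernel_series:
  assumes p: "Re p > 0"
  shows "(\<lambda>n. of_real ((- s) ^ n / fact n) * (2 powr (p + of_nat n / 2) * Gamma (p + of_nat n / 2) / 2))
    sums (of_real (exp (s\<^sup>2 / 4)) * (LINT t:{0<..}|lborel. parabolic_kernel p t s))"
proof -
  let ?m = "\<lambda>n t. complex_of_real t powr (2 * p + of_nat n - 1) * complex_of_real (exp (- (1/2) * t\<^sup>2))"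
  let ?c = "\<lambda>n. complex_of_real ((- s) ^ n / fact n)"
  let ?g = "\<lambda>t. complex_of_real t powr (2 * p - 1) * of_real (exp (- s * t) * exp (- (1/2) * t\<^sup>2))"
  have cn: "Re (2 * p + of_nat n) > 0" for n using p by simp
  have int: "(LINT t:{0<..}|lborel. ?c n * ?m n t) = ?c n * (2 powr (p + of_nat n / 2) * Gamma (p + of_nat n / 2) / 2)" for n
  proof -
    have "(LINT t:{0<..}|lborel. ?m n t) = of_real (1/2) powr (- ((2 * p + of_nat n) / 2)) * Gamma ((2 * p + of_nat n) / 2) / 2"
      by (rule Gaussian_Mellin(2)[OF cn]) simp
    also have "(2 * p + of_nat n) / 2 = p + of_nat n / 2" by (simp add: add_divide_distrib)
    also have "complex_of_real (1/2) powr (- w) = of_real 2 powr w" for w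
      using powr_of_real_eq_exp[of "1/2" "- w"] powr_of_real_eq_exp[of 2 w] by (simp add: ln_div)
    finally have eq: "(LINT t:{0<..}|lborel. ?m n t) = 2 powr (p + of_nat n / 2) * Gamma (p + of_nat n / 2) / 2" by simp
    show ?thesis by (subst set_integral_mult_right) (simp only: eq)
  qed
  have "(\<lambda>n. LINT t:{0<..}|lborel. ?c n * ?m n t) sums (LINT t:{0<..}|lborel. ?g t)"
  proof (rule set_integral_sums_dominated)
    show "set_integrable lborel {0<..} (\<lambda>t. ?c n * ?m n t)" for n
      by (intro set_integrable_mult_right Gaussian_Mellin(1)[OF cn]) simp
    show "set_integrable lborel {0<..} (\<lambda>t::real. exp (s\<^sup>2) * (t powr (2 * Re p - 1) * exp (- (1/4) * t\<^sup>2)))"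
      using p by (intro set_integrable_mult_right Gaussian_Mellin_real) auto
    show "set_borel_measurable borel {0<..} ?g"
      by (intro set_borel_measurable_continuous_open) (auto intro!: continuous_intros)
    fix t :: real assume "t \<in> {0<..}"
    then have t: "t > 0" by simp
    have m: "?c n * ?m n t = of_real t powr (2 * p - 1) * of_real ((- s * t) ^ n / fact n * exp (- (1/2) * t\<^sup>2))" for n
    proof -
      have "complex_of_real t powr (2 * p + of_nat n - 1) = of_real t powr (2 * p - 1 + of_nat n)"
        by (simp add: algebra_simps)
      also have "\<dots> = of_real t powr (2 * p - 1) * of_real t ^ n"
        using t by (simp add: powr_add powr_nat)
      finally show ?thesis by (simp add: power_mult_distrib power_minus[of s] power_minus[of "s * t"])
    qed
    have es: "(\<lambda>n. (- s * t) ^ n / fact n) sums exp (- s * t)"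
      using exp_converges[of "- s * t"] by (simp add: scaleR_conv_of_real divide_inverse mult.commute)
    show "(\<lambda>n. ?c n * ?m n t) sums ?g t"
      unfolding m by (intro sums_mult sums_mult2 sums_of_real es)
    fix N
    have "\<bar>\<Sum>n<N. (- s * t) ^ n / fact n * exp (- (1/2) * t\<^sup>2)\<bar> \<le> (\<Sum>n<N. \<bar>(- s * t) ^ n / fact n * exp (- (1/2) * t\<^sup>2)\<bar>)"
      by (rule sum_abs)
    also have "\<dots> = (\<Sum>n<N. (\<bar>s\<bar> * t) ^ n / fact n) * exp (- (1/2) * t\<^sup>2)"
      unfolding sum_distrib_right using t by (intro sum.cong) (auto simp: abs_mult power_abs)
    also have "(\<Sum>n<N. (\<bar>s\<bar> * t) ^ n / fact n) \<le> exp (\<bar>s\<bar> * t)"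
      using exp_converges[of "\<bar>s\<bar> * t"] t
      by (intro sum_le_suminf[THEN order_trans]) (auto simp: sums_iff divide_inverse mult.commute)
    also have "exp (\<bar>s\<bar> * t) * exp (- (1/2) * t\<^sup>2) \<le> exp (s\<^sup>2) * exp (- (1/4) * t\<^sup>2)"
      by (rule exp_kernel_dominated[OF t])
    finally have le: "\<bar>\<Sum>n<N. (- s * t) ^ n / fact n * exp (- (1/2) * t\<^sup>2)\<bar> \<le> exp (s\<^sup>2) * exp (- (1/4) * t\<^sup>2)"
      by simp
    have "(\<Sum>n<N. ?c n * ?m n t) = of_real t powr (2 * p - 1) * of_real (\<Sum>n<N. (- s * t) ^ n / fact n * exp (- (1/2) * t\<^sup>2))"
      unfolding m by (simp only: of_real_sum sum_distrib_left)
    then have "norm (\<Sum>n<N. ?c n * ?m n t) = t powr (2 * Re p - 1) * \<bar>\<Sum>n<N. (- s * t) ^ n / fact n * exp (- (1/2) * t\<^sup>2)\<bar>"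
      using t by (simp only: norm_mult norm_of_real_powr norm_of_real) simp
    also have "\<dots> \<le> t powr (2 * Re p - 1) * (exp (s\<^sup>2) * exp (- (1/4) * t\<^sup>2))"
      using le by (intro mult_left_mono) auto
    finally show "norm (\<Sum>n<N. ?c n * ?m n t) \<le> exp (s\<^sup>2) * (t powr (2 * Re p - 1) * exp (- (1/4) * t\<^sup>2))"
      by (simp only: mult_ac)
  qed
  also have "(LINT t:{0<..}|lborel. ?g t) = (LINT t:{0<..}|lborel. of_real (exp (s\<^sup>2 / 4)) * parabolic_kernel p t s)"
  proof (intro set_lebesgue_integral_cong allI impI)
    fix t :: real
    have "exp (- s * t) * exp (- (1/2) * t\<^sup>2) = exp (s\<^sup>2 / 4) * exp (- (s\<^sup>2 / 4) - t\<^sup>2 / 2 - s * t)"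
      by (simp flip: exp_add)
    then show "?g t = of_real (exp (s\<^sup>2 / 4)) * parabolic_kernel p t s"
      unfolding parabolic_kernel_def by (simp only: of_real_mult mult_ac)
  qed simp
  finally show ?thesis
    unfolding int by simp
qed

text \<open>Duplication for factorials: it turns the even and odd coefficients of an exponential
  series into Kummer coefficients with lower parameter 1/2 and 3/2.\<close>

lemma pochhammer_half_fact:
  "fact (2 * m) = (4 ^ m * fact m * pochhammer (1/2) m :: complex)"
  "fact (2 * m + 1) = (4 ^ m * fact m * pochhammer (3/2) m :: complex)"
proof -
  show 1: "fact (2 * m) = (4 ^ m * fact m * pochhammer (1/2) m :: complex)"
    by (induction m) (simp_all add: pochhammer_Suc field_simps)
  show "fact (2 * m + 1) = (4 ^ m * fact m * pochhammer (3/2) m :: complex)"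
    by (induction m) (simp_all add: pochhammer_Suc field_simps)
qed

lemma not_nonpos_Ints: "Re p > 0 \<Longrightarrow> p \<notin> \<int>\<^sub>\<le>\<^sub>0"
  by (auto elim!: nonpos_Ints_cases)

lemma Gamma_add_nat: "Re p > 0 \<Longrightarrow> Gamma (p + of_nat m) = pochhammer p m * Gamma p"
  using pochhammer_Gamma[of p m] not_nonpos_Ints[of p] by (simp add: Gamma_eq_zero_iff)

text \<open>Grouping the power series in pairs separates even and odd powers of \<open>s\<close>.
  Since Gamma(p + m) is a Pochhammer symbol times Gamma(p), each half is a Kummer series in
  s^2/2.\<close>

lemma parabolic_kernel_integral:
  assumes p: "Re p > 0"
  shows "of_real (exp (s\<^sup>2 / 4)) * (LINT t:{0<..}|lborel. parabolic_kernel p t s) =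
     2 powr p * Gamma p / 2 * kummerM p (1/2) (of_real s ^ 2 / 2)
     - 2 powr (p + 1/2) * Gamma (p + 1/2) / 2 * (of_real s * kummerM (p + 1/2) (3/2) (of_real s ^ 2 / 2))"
    (is "?I = ?A - ?B")
proof -
  define T where "T n = of_real ((- s) ^ n / fact n) * (2 powr (p + of_nat n / 2) * Gamma (p + of_nat n / 2) / 2)" for n
  have "T sums ?I" unfolding T_def by (rule parabolic_kernel_series[OF p])
  from sums_group[OF this, of 2] have all: "(\<lambda>m. T (2 * m) + T (2 * m + 1)) sums ?I"
    by (simp add: mult.commute numeral_2_eq_2)
  have even: "(\<lambda>m. T (2 * m)) sums ?A"
  proof -
    have "T (2 * m) = 2 powr p * Gamma p / 2 * (pochhammer p m / (pochhammer (1/2) m * fact m) * (of_real s ^ 2 / 2) ^ m)" for m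
    proof -
      have "T (2 * m) = of_real s ^ (2 * m) / (4 ^ m * fact m * pochhammer (1/2) m) * ((2 powr p * 2 ^ m) * (pochhammer p m * Gamma p) / 2)"
        unfolding T_def pochhammer_half_fact(1)[symmetric] Gamma_add_nat[OF p, symmetric]
        by (simp add: powr_add powr_nat)
      moreover have "(4::complex) ^ m = 2 ^ m * 2 ^ m" by (simp flip: power_mult_distrib)
      moreover have "(complex_of_real s ^ 2 / 2) ^ m = of_real s ^ (2 * m) / 2 ^ m"
        by (simp only: power_divide power_mult)
      ultimately show ?thesis by (simp add: mult_ac del: of_real_power)
    qed
    then show ?thesis by (simp only:) (rule sums_mult[OF kummerM_sums])
  qed
  have odd: "(\<lambda>m. T (2 * m + 1)) sums (- ?B)"
  proof -
    have q: "Re (p + 1/2) > 0" using p by simp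
    have "T (2 * m + 1) = - (2 powr (p + 1/2) * Gamma (p + 1/2) / 2 * (of_real s *
        (pochhammer (p + 1/2) m / (pochhammer (3/2) m * fact m) * (of_real s ^ 2 / 2) ^ m)))" for m
    proof -
      have e: "p + of_nat (2 * m + 1) / 2 = p + 1/2 + of_nat m" by (simp add: add_divide_distrib)
      have "T (2 * m + 1) = - (of_real s ^ (2 * m + 1)) / (4 ^ m * fact m * pochhammer (3/2) m) *
          ((2 powr (p + 1/2) * 2 ^ m) * (pochhammer (p + 1/2) m * Gamma (p + 1/2)) / 2)"
        unfolding T_def e pochhammer_half_fact(2)[symmetric] Gamma_add_nat[OF q, symmetric]
        by (simp add: powr_add[of _ _ "of_nat m"] powr_nat)
      moreover have "(4::complex) ^ m = 2 ^ m * 2 ^ m" by (simp flip: power_mult_distrib)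
      moreover have "(complex_of_real s ^ 2 / 2) ^ m = of_real s ^ (2 * m) / 2 ^ m"
        by (simp only: power_divide power_mult)
      ultimately show ?thesis by (simp add: mult_ac del: of_real_power)
    qed
    then show ?thesis by (simp only:) (rule sums_minus[OF sums_mult[OF sums_mult[OF kummerM_sums]]])
  qed
  from sums_unique2[OF all sums_add[OF even odd]] show ?thesis by (simp only: add_uminus_conv_diff)
qed

lemma Gamma_duplication_powr:
  assumes p: "Re p > 0"
  shows "Gamma p * Gamma (p + 1/2) = 2 * 2 powr (- p) * 2 powr (- p) * of_real (sqrt pi) * Gamma (2 * p)"
proof -
  have "exp ((1 - 2 * p) * of_real (ln 2)) = (2::complex) powr (1 + - p + - p)"
    using powr_of_real_eq_exp[of 2 "1 - 2 * p"] by simp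
  also have "\<dots> = 2 * 2 powr (- p) * 2 powr (- p)" by (simp only: powr_add) simp
  finally show ?thesis
    using Gamma_legendre_duplication[of p] not_nonpos_Ints[of p] not_nonpos_Ints[of "p + 1/2"] p by simp
qed

text \<open>At parameter \<open>2 * p - 1/2\<close> the Gamma arguments in \<open>pcfU\<close>
  become \<open>p + 1/2\<close> and \<open>p\<close>. Legendre duplication makes both coefficients
  the same multiple, \<open>rGamma (2 * p)\<close>, of those in
  \<open>parabolic_kernel_integral\<close>.\<close>

lemma pcfU_kernel_integral:
  assumes p: "Re p > 0"
  shows "pcfU (2 * p - 1/2) (of_real s) = rGamma (2 * p) * (LINT t:{0<..}|lborel. parabolic_kernel p t s)"
proof -
  have nz: "Gamma p \<noteq> 0" "Gamma (p + 1/2) \<noteq> 0" "Gamma (2 * p) \<noteq> 0"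
    using p by (auto simp: Gamma_eq_zero_iff not_nonpos_Ints)
  have r: "2 * 2 powr p \<noteq> (0::complex)" by simp
  note dup = Gamma_duplication_powr[OF p]
  have h: "2 powr (p + 1/2) * 2 powr (p - 1/2) = (2 powr p * 2 powr p :: complex)"
    by (simp flip: powr_add)
  have 1: "of_real (sqrt pi) * rGamma (p + 1/2) / 2 powr p = rGamma (2 * p) * (2 powr p * Gamma p / 2)"
    using dup nz r by (simp add: rGamma_inverse_Gamma powr_minus field_simps)
  have 2: "of_real (sqrt pi) * rGamma p / 2 powr (p - 1/2) = rGamma (2 * p) * (2 powr (p + 1/2) * Gamma (p + 1/2) / 2)"
    using dup nz r h by (simp add: rGamma_inverse_Gamma powr_minus field_simps)
  have e: "exp (- (of_real s ^ 2) / 4) * complex_of_real (exp (s\<^sup>2 / 4)) = 1"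
    by (simp flip: exp_of_real exp_add)
  have "pcfU (2 * p - 1/2) (of_real s) = exp (- (of_real s ^ 2) / 4) *
     (of_real (sqrt pi) * rGamma (p + 1/2) / 2 powr p * kummerM p (1/2) (of_real s ^ 2 / 2)
      - of_real (sqrt pi) * rGamma p / 2 powr (p - 1/2) * (of_real s * kummerM (p + 1/2) (3/2) (of_real s ^ 2 / 2)))"
  proof -
    have "3/4 + (2 * p - 1/2) / 2 = p + 1/2" "(2 * p - 1/2) / 2 + 1/4 = p" "1/4 + (2 * p - 1/2) / 2 = p"
      "(2 * p - 1/2) / 2 - 1/4 = p - 1/2" "(2 * p - 1/2) / 2 + 3/4 = p + 1/2"
      by (simp_all add: field_simps)
    then show ?thesis unfolding pcfU_def by (simp only:) (simp add: algebra_simps)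
  qed
  also have "\<dots> = exp (- (of_real s ^ 2) / 4) * (rGamma (2 * p) * (of_real (exp (s\<^sup>2 / 4)) * (LINT t:{0<..}|lborel. parabolic_kernel p t s)))"
    unfolding 1 2 parabolic_kernel_integral[OF p] by (simp add: algebra_simps)
  also have "\<dots> = (exp (- (of_real s ^ 2) / 4) * complex_of_real (exp (s\<^sup>2 / 4))) * (rGamma (2 * p) * (LINT t:{0<..}|lborel. parabolic_kernel p t s))"
    by (simp only: mult_ac)
  finally show ?thesis unfolding e by simp
qed

section \<open>The Weber function and its primitives\<close>

lemma pcfU_holomorphic: "pcfU b holomorphic_on UNIV"
proof -
  have k: "(\<lambda>z. kummerM c d (z\<^sup>2 / 2)) holomorphic_on UNIV" for c d
  proof -
    have "(\<lambda>z::complex. z\<^sup>2 / 2) holomorphic_on UNIV" by (intro holomorphic_intros) auto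
    from holomorphic_on_compose_gen[OF this kummerM_holomorphic] show ?thesis by (simp add: o_def)
  qed
  show ?thesis
    unfolding pcfU_def[abs_def] by (intro holomorphic_intros k) auto
qed

lemma continuous_on_pcfU_real: "continuous_on S (\<lambda>s. pcfU b (complex_of_real s))"
  using continuous_on_compose2[OF holomorphic_on_imp_continuous_on[OF pcfU_holomorphic], of S complex_of_real b]
  by (simp add: continuous_on_of_real_id)

text \<open>Integrability of the kernel on the quadrant gives that of U on the half line; the value
  combines the quadrant and quadratic integrals with duplication. The limit form is the one that
  \<open>ray_integral\<close> takes.\<close>

lemma pcfU_half_line_integral:
  assumes p: "Re p > 0"
  shows "((\<lambda>R. integral {0..R} (\<lambda>s. pcfU (2 * p - 1/2) (of_real s))) \<longlongrightarrow>
           2 powr (- p) * of_real (sqrt pi) * rGamma p * half_beta p) at_top"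
proof -
  let ?u = "\<lambda>s. pcfU (2 * p - 1/2) (complex_of_real s)"
  let ?F = "\<lambda>t s. indicator {0<..} t *\<^sub>R indicator {0<..} s *\<^sub>R parabolic_kernel p t s"
  have nz: "Gamma p \<noteq> 0" "Gamma (p + 1/2) \<noteq> 0" "Gamma (2 * p) \<noteq> 0"
    using p by (auto simp: Gamma_eq_zero_iff not_nonpos_Ints)
  have um: "?u \<in> borel_measurable lborel"
    using borel_measurable_continuous_onI[OF continuous_on_pcfU_real] by simp
  have uF: "indicator {0<..} s *\<^sub>R ?u s = rGamma (2 * p) * (\<integral>t. ?F t s \<partial>lborel)" for s
    using pcfU_kernel_integral[OF p, of s] by (simp add: set_lebesgue_integral_def indicator_def)
  have "integrable lborel (\<lambda>s. \<integral>t. ?F t s \<partial>lborel)"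
    using lborel_pair.integrable_snd[OF integrable_parabolic_kernel[OF p]] .
  then have int: "integrable lborel (\<lambda>s. indicator {0<..} s *\<^sub>R ?u s)"
    unfolding uF by (rule integrable_mult_right)
  \<comment> \<open>The kernel lives on the open half line while the truncated integrals include 0;
    the two differ by a null set.\<close>
  have "AE s in lborel. s \<noteq> (0::real)" by (rule AE_lborel_singleton)
  then have ae: "AE s in lborel. indicator {0<..} s *\<^sub>R ?u s = indicator {0..} s *\<^sub>R ?u s"
    by eventually_elim (auto simp: indicator_def)
  have int0: "set_integrable lborel {0..} ?u"
    unfolding set_integrable_def
    by (rule integrable_cong_AE_imp[OF int]) (use um ae in \<open>auto elim: eventually_mono\<close>)
  have "(LINT s:{0..}|lborel. ?u s) = (\<integral>s. indicator {0<..} s *\<^sub>R ?u s \<partial>lborel)"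
    unfolding set_lebesgue_integral_def
    by (rule integral_cong_AE) (use um ae in \<open>auto elim: eventually_mono\<close>)
  also have "\<dots> = rGamma (2 * p) * (\<integral>s. (\<integral>t. ?F t s \<partial>lborel) \<partial>lborel)"
    unfolding uF by (rule integral_mult_right_zero)
  also have "(\<integral>s. (\<integral>t. ?F t s \<partial>lborel) \<partial>lborel) = (LINT s:{0<..}|lborel. LINT t:{0<..}|lborel. parabolic_kernel p t s)"
    unfolding set_lebesgue_integral_def
    by (intro Bochner_Integration.integral_cong refl) (auto simp: indicator_def)
  also have "\<dots> = Gamma (p + 1/2) / 2 * (2 powr p * half_beta p)"
    unfolding parabolic_kernel_quadrant[OF p] quadratic_powr_integral[OF p] ..
  also have "rGamma (2 * p) * (Gamma (p + 1/2) / 2 * (2 powr p * half_beta p)) =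
      2 powr (- p) * of_real (sqrt pi) * rGamma p * half_beta p"
    using Gamma_duplication_powr[OF p] nz by (simp add: rGamma_inverse_Gamma powr_minus field_simps)
  finally have val: "(LINT s:{0..}|lborel. ?u s) = 2 powr (- p) * of_real (sqrt pi) * rGamma p * half_beta p" .
  have "((\<lambda>R. LINT s:{0..R}|lborel. ?u s) \<longlongrightarrow> (LINT s:{0..}|lborel. ?u s)) at_top"
    by (rule tendsto_set_lebesgue_integral_at_top[OF _ int0]) simp
  moreover have "(LINT s:{0..R}|lborel. ?u s) = integral {0..R} ?u" for R
    by (rule set_borel_integral_eq_integral(2), rule set_integrable_subset[OF int0]) auto
  ultimately show ?thesis unfolding val by simp
qed

section \<open>Integrals of entire functions to infinity along rays\<close>

lemma entire_contour_integral_linepath: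
  assumes f: "f holomorphic_on UNIV"
  obtains F where "\<And>z. (F has_field_derivative f z) (at z)"
    "\<And>x y. contour_integral (linepath x y) f = F y - F x"
proof -
  obtain F where F: "\<And>z. (F has_field_derivative f z) (at z)"
    using holomorphic_convex_primitive'[OF convex_UNIV open_UNIV f] by auto
  moreover have "contour_integral (linepath x y) f = F y - F x" for x y
    using contour_integral_primitive[of UNIV F f "linepath x y"] F
    by (intro contour_integral_unique) auto
  ultimately show ?thesis using that by blast
qed

text \<open>By a global primitive, the segment from \<open>z\<close> to a point of the ray can be
  replaced by the segment from 0 to that point minus the one from 0 to \<open>z\<close>. The former
  is \<open>w\<close> times a real-variable integral.\<close>

lemma entire_ray_limit:
  assumes f: "f holomorphic_on UNIV"
    and lim: "((\<lambda>R. integral {0..R} (\<lambda>s. f (of_real s * w))) \<longlongrightarrow> L) at_top"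
  shows "((\<lambda>R. contour_integral (linepath z (of_real R * w)) f) \<longlongrightarrow> w * L - contour_integral (linepath 0 z) f) at_top"
proof -
  obtain F where F: "\<And>z. (F has_field_derivative f z) (at z)"
    "\<And>x y. contour_integral (linepath x y) f = F y - F x"
    using entire_contour_integral_linepath[OF f] by blast
  have ev: "w * integral {0..R} (\<lambda>s. f (of_real s * w)) = F (of_real R * w) - F 0" if "R \<ge> 0" for R
  proof -
    have "((\<lambda>s. f (of_real s * w) * w) has_integral F (of_real R * w) - F (of_real 0 * w)) {0..R}"
    proof (rule fundamental_theorem_of_calculus[OF that])
      fix x :: real
      have "((\<lambda>s. F (s * w)) has_field_derivative (f (of_real x * w) * w)) (at (of_real x))"
        by (rule DERIV_chain2[OF F(1)]) (auto intro!: derivative_eq_intros)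
      then show "((\<lambda>s. F (of_real s * w)) has_vector_derivative f (of_real x * w) * w) (at x within {0..R})"
        using has_vector_derivative_real_field has_vector_derivative_at_within by blast
    qed
    from integral_unique[OF this] show ?thesis by (simp add: mult.commute)
  qed
  have "((\<lambda>R. w * integral {0..R} (\<lambda>s. f (of_real s * w)) + F 0 - F z) \<longlongrightarrow> w * L + F 0 - F z) at_top"
    by (intro tendsto_intros lim)
  moreover have "eventually (\<lambda>R. w * integral {0..R} (\<lambda>s. f (of_real s * w)) + F 0 - F z = contour_integral (linepath z (of_real R * w)) f) at_top"
    using eventually_ge_at_top[of 0] by eventually_elim (simp add: ev F(2))
  ultimately have "((\<lambda>R. contour_integral (linepath z (of_real R * w)) f) \<longlongrightarrow> w * L + F 0 - F z) at_top"
    using Lim_transform_eventually by fast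
  then show ?thesis by (simp add: F(2) algebra_simps)
qed

lemma ray_integral_eq:
  assumes "f holomorphic_on UNIV"
    and "((\<lambda>R. integral {0..R} (\<lambda>s. f (of_real s * exp (\<i> * complex_of_real \<theta>)))) \<longlongrightarrow> L) at_top"
  shows "ray_integral f z \<theta> = exp (\<i> * complex_of_real \<theta>) * L - contour_integral (linepath 0 z) f"
  unfolding ray_integral_def by (rule tendsto_Lim[OF _ entire_ray_limit[OF assms]]) simp

text \<open>The primitive eighth root of unity. Naming it reduces all phases of \<open>Wj\<close> to
  products of \<open>cis8\<close> and its conjugate.\<close>

definition cis8 :: complex where "cis8 = exp (\<i> * complex_of_real (pi / 4))"

lemma cis8:
  "exp (\<i> * complex_of_real (- pi / 4)) = cnj cis8"
  "exp (- complex_of_real pi * \<i> / 4) = cnj cis8"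
  "cis8 * cnj cis8 = 1" "cis8 * cis8 = \<i>" "cnj cis8 * cnj cis8 = - \<i>"
  "\<i> * cnj cis8 = cis8" "\<i> * cis8 = - cnj cis8"
proof -
  show 1: "exp (\<i> * complex_of_real (- pi / 4)) = cnj cis8"
    unfolding cis8_def exp_cnj by simp
  show "exp (- complex_of_real pi * \<i> / 4) = cnj cis8"
    unfolding 1[symmetric] by (simp add: field_simps)
  show 2: "cis8 * cnj cis8 = 1"
    unfolding cis8_def exp_cnj by (simp flip: exp_add)
  show 3: "cis8 * cis8 = \<i>"
    unfolding cis8_def using cis_mult[of "pi/4" "pi/4"] cis_pi_half by (simp add: cis_conv_exp)
  show 4: "cnj cis8 * cnj cis8 = - \<i>"
    using arg_cong[OF 3, of cnj] by simp
  show "\<i> * cnj cis8 = cis8" unfolding 3[symmetric] using 2 by (simp add: mult.assoc)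
  show "\<i> * cis8 = - cnj cis8"
  proof -
    have "\<i> * cis8 = - (- \<i> * cis8)" by simp
    also have "- \<i> * cis8 = cnj cis8 * (cis8 * cnj cis8)" unfolding 4[symmetric] by (simp only: mult_ac)
    finally show ?thesis unfolding 2 by simp
  qed
qed

lemma cnj_powr_of_real: "0 < x \<Longrightarrow> cnj (complex_of_real x powr z) = of_real x powr (cnj z)"
  by (simp add: powr_of_real_eq_exp exp_cnj)

lemma half_beta_cnj: "cnj (half_beta p) = half_beta (cnj p)"
proof -
  have "cnj (half_beta p) = (LINT u:{0<..<1}|lborel. cnj (of_real u powr (p - 1) * of_real (1 / sqrt (1 + u))))"
    unfolding half_beta_def set_lebesgue_integral_def
    by (simp only: complex_cnj_scaleR[symmetric]) (rule Bochner_Integration.integral_cnj[symmetric])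
  also have "\<dots> = half_beta (cnj p)"
    unfolding half_beta_def by (intro set_lebesgue_integral_cong) (auto simp: cnj_powr_of_real)
  finally show ?thesis .
qed

lemma Wj_0: "Wj 0 a z = pcfU (\<i> * of_real a) (z * cnj cis8)"
  unfolding Wj_def using cis8(2) by simp

lemma Wj_3: "Wj 3 a z = pcfU (- \<i> * of_real a) (z * cis8)"
proof -
  have "(-\<i>) ^ 3 * z * exp (- complex_of_real pi * \<i> / 4) = z * (\<i> * cnj cis8)"
    unfolding cis8(2) by (simp add: power3_eq_cube)
  then show ?thesis unfolding Wj_def cis8(6) by simp
qed

lemma Wj_holomorphic: "Wj j a holomorphic_on UNIV"
proof -
  have "(\<lambda>z. pcfU c (d * z * e)) holomorphic_on UNIV" for c d e
  proof -
    have "(\<lambda>z. d * z * e) holomorphic_on UNIV" by (intro holomorphic_intros)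
    from holomorphic_on_compose_gen[OF this pcfU_holomorphic] show ?thesis by (simp add: o_def)
  qed
  then show ?thesis unfolding Wj_def[abs_def] .
qed

text \<open>Here \<open>al\<close> is U(ia, 0) and \<open>be\<close> is -U'(ia, 0). With p = 1/4 +
  ia/2 the conjugate of \<open>p\<close> is 1 - (p + 1/2), so \<open>al * cnj be\<close> is a
  reflection product, whereas \<open>al * be\<close> is a duplication product.\<close>

lemma weber_constants:
  fixes a :: real
  defines "al \<equiv> of_real (sqrt pi) * rGamma (3/4 + \<i> * of_real a / 2) / (2 powr (\<i> * of_real a / 2 + 1/4))"
    and "be \<equiv> of_real (sqrt pi) * rGamma (1/4 + \<i> * of_real a / 2) / (2 powr (\<i> * of_real a / 2 - 1/4))"
  shows "al * cnj be * cis8 = of_real (exp (pi * a / 2) / 2) + \<i> * of_real (exp (- (pi * a / 2)) / 2)"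
    and "al * be = of_real (sqrt (pi / 2)) * rGamma (1/2 + \<i> * of_real a)"
proof -
  define p where "p = 1/4 + \<i> * complex_of_real a / 2"
  have p: "Re p > 0" by (simp add: p_def)
  have p': "3/4 + \<i> * complex_of_real a / 2 = p + 1/2" "\<i> * complex_of_real a / 2 + 1/4 = p"
    "\<i> * complex_of_real a / 2 - 1/4 = p - 1/2" "1/2 + \<i> * complex_of_real a = 2 * p"
    by (simp_all add: p_def field_simps)
  have al: "al = of_real (sqrt pi) * rGamma (p + 1/2) / 2 powr p"
    and be: "be = of_real (sqrt pi) * rGamma p / 2 powr (p - 1/2)"
    unfolding al_def be_def p' p_def[symmetric] by simp_all
  have cp: "cnj p = 1 - (p + 1/2)" by (simp add: p_def complex_eq_iff)
  have nz: "Gamma p \<noteq> 0" "Gamma (p + 1/2) \<noteq> 0" "Gamma (2 * p) \<noteq> 0"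
    using p by (auto simp: Gamma_eq_zero_iff not_nonpos_Ints)
  have sq: "complex_of_real (sqrt pi) * of_real (sqrt pi) = of_real pi"
    by (simp flip: of_real_mult)
  have "cnj (2 powr (p - 1/2)) = (2::complex) powr (cnj p - 1/2)"
    using cnj_powr_of_real[of 2 "p - 1/2"] by simp
  also have "cnj p - 1/2 = - p" unfolding cp by simp
  finally have pw: "cnj (2 powr (p - 1/2)) * 2 powr p = (1::complex)"
    by (simp flip: powr_add)
  have "al * cnj be = (of_real (sqrt pi) * of_real (sqrt pi)) * (rGamma (p + 1/2) * rGamma (1 - (p + 1/2))) / (cnj (2 powr (p - 1/2)) * 2 powr p)"
    unfolding al be complex_cnj_divide complex_cnj_mult cnj_rGamma cp by (simp add: mult_ac)
  also have "\<dots> = sin (of_real pi * (p + 1/2))"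
    unfolding pw sq rGamma_reflection_complex by simp
  also have "\<dots> = (exp (\<i> * (of_real pi * (p + 1/2))) - exp (- (\<i> * (of_real pi * (p + 1/2))))) / (2 * \<i>)"
    by (rule sin_exp_eq)
  \<comment> \<open>The phase 3 pi/4 is split as pi - pi/4 so that the exponential becomes
    \<open>- cnj cis8\<close> times a real factor.\<close>
  also have "\<i> * (of_real pi * (p + 1/2)) = \<i> * of_real pi + \<i> * of_real (- pi / 4) + of_real (- (pi * a / 2))"
    by (simp add: p_def complex_eq_iff field_simps)
  also have "exp \<dots> = - cnj cis8 * of_real (exp (- (pi * a / 2)))"
    unfolding exp_add cis8(1) exp_of_real by (simp add: exp_pi_i')
  also have "- (\<i> * of_real pi + \<i> * of_real (- pi / 4) + of_real (- (pi * a / 2))) =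
      - (\<i> * of_real pi) + \<i> * complex_of_real (pi / 4) + of_real (pi * a / 2)"
    by simp
  also have "exp \<dots> = - cis8 * of_real (exp (pi * a / 2))"
    unfolding exp_add exp_of_real by (simp add: exp_minus exp_pi_i' cis8_def)
  finally have alcbe: "al * cnj be = (- cnj cis8 * of_real (exp (- (pi * a / 2))) - - cis8 * of_real (exp (pi * a / 2))) / (2 * \<i>)" .
  have "al * cnj be * cis8 = ((cis8 * cis8) * of_real (exp (pi * a / 2)) - (cis8 * cnj cis8) * of_real (exp (- (pi * a / 2)))) / (2 * \<i>)"
    unfolding alcbe by (simp add: algebra_simps)
  then show "al * cnj be * cis8 = of_real (exp (pi * a / 2) / 2) + \<i> * of_real (exp (- (pi * a / 2)) / 2)"
  proof -
    have *: "\<i> * X - Y = (X / 2 + \<i> * (Y / 2)) * (2 * \<i>)" for X Y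
      by (simp add: complex_eq_iff)
    have "(\<i> * X - Y) / (2 * \<i>) = X / 2 + \<i> * (Y / 2)" for X Y
      unfolding *[of X Y] by (rule nonzero_mult_div_cancel_right) simp
    then show ?thesis
      using \<open>al * cnj be * cis8 = _\<close> unfolding cis8(3,4) by simp
  qed
  have h: "(2::complex) powr (p - 1/2) = 2 powr p / of_real (sqrt 2)"
    using powr_of_real[of 2 "1/2"] by (simp add: powr_diff powr_half_sqrt)
  have s2: "complex_of_real (sqrt 2) * of_real (sqrt 2) = 2"
    by (simp flip: of_real_mult)
  have "al * be = (of_real (sqrt pi) * of_real (sqrt pi)) * of_real (sqrt 2) / (Gamma p * Gamma (p + 1/2) * 2 powr p * 2 powr p)"
    unfolding al be h rGamma_inverse_Gamma by (simp add: divide_simps)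
  also have "\<dots> = of_real (sqrt pi) * of_real (sqrt 2) / (2 * Gamma (2 * p))"
    unfolding Gamma_duplication_powr[OF p] using nz by (simp add: powr_minus field_simps)
  also have "\<dots> = of_real (sqrt (pi / 2)) * rGamma (2 * p)"
    unfolding s2[symmetric] using nz by (simp add: rGamma_inverse_Gamma real_sqrt_divide field_simps)
  finally show "al * be = of_real (sqrt (pi / 2)) * rGamma (1/2 + \<i> * of_real a)" unfolding p' .
qed

text \<open>On the line Re z = 1/2 conjugation is z to 1 - z, so the squared modulus is a reflection
  product.\<close>

lemma Gamma_half_line_modulus: "(norm (Gamma (1/2 + \<i> * complex_of_real a)))\<^sup>2 = pi / cosh (pi * a)"
proof -
  let ?z = "1/2 + \<i> * complex_of_real a"
  have "complex_of_real ((norm (Gamma ?z))\<^sup>2) = Gamma ?z * Gamma (1 - ?z)"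
    by (simp only: complex_norm_square cnj_Gamma) (rule arg_cong, simp add: complex_eq_iff)
  also have "\<dots> = of_real pi / sin (of_real pi * ?z)" by (rule Gamma_reflection_complex)
  also have "of_real pi * ?z = \<i> * of_real (pi * a) + of_real pi / 2" by (simp add: algebra_simps)
  also have "sin (\<i> * of_real (pi * a) + of_real pi / 2) = cos (\<i> * complex_of_real (pi * a))"
    by (simp only: sin_cos_eq) simp
  also have "\<dots> = of_real (cosh (pi * a))"
    by (simp add: cosh_def cos_exp_eq scaleR_conv_of_real exp_minus exp_of_real flip: of_real_mult)
  finally show ?thesis by (metis of_real_divide of_real_eq_iff)
qed

text \<open>The even solution of y'' + (z^2/4 - a) y = 0 with value 1 at 0; \<open>weber_odd\<close>
  is the odd one with slope 1 at 0. They are the standard pair for U(ia, .) at the rotated argument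
  z e^(-i pi/4), the odd one rescaled.\<close>

definition weber_even :: "real \<Rightarrow> complex \<Rightarrow> complex" where
  "weber_even a z = exp (\<i> * z\<^sup>2 / 4) * kummerM (\<i> * of_real a / 2 + 1/4) (1/2) (- (\<i> * z\<^sup>2) / 2)"

definition weber_odd :: "real \<Rightarrow> complex \<Rightarrow> complex" where
  "weber_odd a z = z * (exp (\<i> * z\<^sup>2 / 4) * kummerM (\<i> * of_real a / 2 + 3/4) (3/2) (- (\<i> * z\<^sup>2) / 2))"

text \<open>This is U(ia, 0), and \<open>weber_odd_coeff\<close> is -U'(ia, 0).\<close>

definition weber_even_coeff :: "real \<Rightarrow> complex" where
  "weber_even_coeff a = of_real (sqrt pi) * rGamma (3/4 + \<i> * of_real a / 2) / (2 powr (\<i> * of_real a / 2 + 1/4))"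

definition weber_odd_coeff :: "real \<Rightarrow> complex" where
  "weber_odd_coeff a = of_real (sqrt pi) * rGamma (1/4 + \<i> * of_real a / 2) / (2 powr (\<i> * of_real a / 2 - 1/4))"

lemma Wj_0_even_odd: "Wj 0 a z = weber_even_coeff a * weber_even a z - weber_odd_coeff a * cnj cis8 * weber_odd a z"
proof -
  have "(z * cnj cis8)\<^sup>2 = (cnj cis8 * cnj cis8) * z\<^sup>2"
    by (simp only: power2_eq_square mult_ac)
  then have sq: "(z * cnj cis8)\<^sup>2 = - (\<i> * z\<^sup>2)" unfolding cis8(5) by simp
  show ?thesis
    unfolding Wj_0 pcfU_def weber_even_def weber_odd_def weber_even_coeff_def weber_odd_coeff_def sq
    by (simp add: mult_ac)
qed

text \<open>Kummer's transformation shows that replacing i by -i changes neither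
  \<open>weber_even\<close> nor \<open>weber_odd\<close>. So the pair adapted to \<open>Wj 0\<close>
  also expands \<open>Wj 3\<close>, with conjugate coefficients.\<close>

lemma Wj_3_even_odd: "Wj 3 a z = cnj (weber_even_coeff a) * weber_even a z - cnj (weber_odd_coeff a) * cis8 * weber_odd a z"
proof -
  let ?x = "\<i> * complex_of_real a / 2"
  have "(z * cis8)\<^sup>2 = (cis8 * cis8) * z\<^sup>2"
    by (simp only: power2_eq_square mult_ac)
  then have sq: "(z * cis8)\<^sup>2 = \<i> * z\<^sup>2" unfolding cis8(4) by simp
  have nh: "(1/2 :: complex) \<noteq> - of_nat n" "(3/2 :: complex) \<noteq> - of_nat n" for n
    by (auto simp: complex_eq_iff)
  have ex: "exp (\<i> * z\<^sup>2 / 4) * exp (- (\<i> * z\<^sup>2) / 2) = exp (- (\<i> * z\<^sup>2) / 4)"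
    by (simp flip: exp_add)
  have "kummerM (?x + 1/4) (1/2) (- (\<i> * z\<^sup>2) / 2) = exp (- (\<i> * z\<^sup>2) / 2) * kummerM (1/2 - (?x + 1/4)) (1/2) (- (- (\<i> * z\<^sup>2) / 2))"
    by (rule kummer_transformation[OF nh(1)])
  also have "1/2 - (?x + 1/4) = - \<i> * of_real a / 2 + 1/4" by simp
  finally have e: "weber_even a z = exp (- (\<i> * z\<^sup>2) / 4) * kummerM (- \<i> * of_real a / 2 + 1/4) (1/2) (\<i> * z\<^sup>2 / 2)"
    unfolding weber_even_def ex[symmetric] by simp
  have "kummerM (?x + 3/4) (3/2) (- (\<i> * z\<^sup>2) / 2) = exp (- (\<i> * z\<^sup>2) / 2) * kummerM (3/2 - (?x + 3/4)) (3/2) (- (- (\<i> * z\<^sup>2) / 2))"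
    by (rule kummer_transformation[OF nh(2)])
  also have "3/2 - (?x + 3/4) = - \<i> * of_real a / 2 + 3/4" by simp
  finally have o: "weber_odd a z = z * (exp (- (\<i> * z\<^sup>2) / 4) * kummerM (- \<i> * of_real a / 2 + 3/4) (3/2) (\<i> * z\<^sup>2 / 2))"
    unfolding weber_odd_def ex[symmetric] by simp
  have pw: "cnj (2 powr w) = (2::complex) powr (cnj w)" for w
    using cnj_powr_of_real[of 2 w] by simp
  show ?thesis
    unfolding Wj_3 pcfU_def e o weber_even_coeff_def weber_odd_coeff_def sq complex_cnj_divide complex_cnj_mult cnj_rGamma pw
    by (simp add: mult_ac)
qed

lemma weber_even_minus: "weber_even a (- z) = weber_even a z"
  and weber_odd_minus: "weber_odd a (- z) = - weber_odd a z"
  by (simp_all add: weber_even_def weber_odd_def)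

lemma weber_even_odd_holomorphic: "weber_even a holomorphic_on UNIV" "weber_odd a holomorphic_on UNIV"
proof -
  have k: "(\<lambda>z. kummerM c d (- (\<i> * z\<^sup>2) / 2)) holomorphic_on UNIV" for c d
  proof -
    have "(\<lambda>z::complex. - (\<i> * z\<^sup>2) / 2) holomorphic_on UNIV" by (intro holomorphic_intros) auto
    from holomorphic_on_compose_gen[OF this kummerM_holomorphic] show ?thesis by (simp add: o_def)
  qed
  show "weber_even a holomorphic_on UNIV" "weber_odd a holomorphic_on UNIV"
    unfolding weber_even_def[abs_def] weber_odd_def[abs_def] by (intro holomorphic_intros k; simp)+
qed

text \<open>The factors are W(a, 0) and -W'(a, 0), so this says that W(a, z) and W(a, -z) have
  Wronskian 1. The phase \<open>weber_rho\<close> makes the square terms real, and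
  \<open>weber_k\<close> rationalises the sum.\<close>

lemma weber_normalization:
  fixes a :: real
  defines "e \<equiv> exp (\<i> * of_real (weber_rho a))"
    and "K \<equiv> complex_of_real (sqrt (weber_k a / 2) * exp (pi * a / 4))"
  shows "(K * (e * weber_even_coeff a + cnj e * cnj (weber_even_coeff a))) *
         (K * (e * weber_odd_coeff a * cnj cis8 + cnj e * cnj (weber_odd_coeff a) * cis8)) = 1/2"
proof -
  let ?G = "Gamma (1/2 + \<i> * complex_of_real a)" and ?L = "ln_Gamma (1/2 + \<i> * complex_of_real a)"
  define al be where "al = weber_even_coeff a" and "be = weber_odd_coeff a"
  have alcbe: "al * cnj be * cis8 = of_real (exp (pi * a / 2) / 2) + \<i> * of_real (exp (- (pi * a / 2)) / 2)"
    and albe: "al * be = of_real (sqrt (pi / 2)) * rGamma (1/2 + \<i> * of_real a)"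
    unfolding al_def be_def weber_even_coeff_def weber_odd_coeff_def by (rule weber_constants)+
  define X where "X = sqrt (pi / 2) / norm ?G"
  have npos: "1/2 + \<i> * complex_of_real a \<notin> \<int>\<^sub>\<le>\<^sub>0" by (rule not_nonpos_Ints) simp
  then have GL: "exp ?L = ?G" by (simp add: Gamma_complex_altdef)
  have "?G = of_real (exp (Re ?L)) * exp (\<i> * of_real (Im ?L))"
    unfolding GL[symmetric] exp_of_real[symmetric] exp_add[symmetric]
    by (rule arg_cong[of _ _ exp]) (rule complex_eq)
  moreover have "norm ?G = exp (Re ?L)" unfolding GL[symmetric] by (rule norm_exp_eq_Re)
  ultimately have Gp: "?G = of_real (norm ?G) * exp (\<i> * of_real (Im ?L))" by simp
  \<comment> \<open>Doubling \<open>weber_rho\<close> gives arg Gamma + pi/4: the second part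
    cancels \<open>cnj cis8\<close>, the first cancels the phase of \<open>rGamma\<close> in
    \<open>al * be\<close>.\<close>
  have "e * e = exp (\<i> * of_real (Im ?L)) * cis8"
    unfolding e_def weber_rho_def cis8_def exp_add[symmetric]
    by (rule arg_cong[of _ _ exp]) (simp add: algebra_simps)
  then have "e * e * cnj cis8 = exp (\<i> * of_real (Im ?L)) * (cis8 * cnj cis8)" by simp
  then have ee: "e * e * cnj cis8 = exp (\<i> * of_real (Im ?L))" unfolding cis8(3) by simp
  have "(e * e * cnj cis8) * (al * be) = exp (\<i> * of_real (Im ?L)) * (of_real (sqrt (pi / 2)) / ?G)"
    by (simp only: ee albe rGamma_inverse_Gamma divide_inverse)
  also have "\<dots> = of_real X"
  proof -
    have "E * (S / g) = S / n" if "g = n * E" "E \<noteq> 0" for E S g n :: complex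
      using that by simp
    from this[OF Gp exp_not_eq_zero] show ?thesis by (simp only: X_def of_real_divide)
  qed
  finally have X: "(e * e * cnj cis8) * (al * be) = of_real X" .
  from arg_cong[OF this, of cnj] have cX: "(cnj e * cnj e * cis8) * (cnj al * cnj be) = of_real X" by simp
  have ece: "e * cnj e = 1" unfolding e_def exp_cnj by (simp flip: exp_add)
  have alcbe': "cnj al * be * cnj cis8 = of_real (exp (pi * a / 2) / 2) - \<i> * of_real (exp (- (pi * a / 2)) / 2)"
    using arg_cong[OF alcbe, of cnj] by simp
  define \<theta> where "\<theta> = exp (pi * a / 2)"
  have "(e * al + cnj e * cnj al) * (e * be * cnj cis8 + cnj e * cnj be * cis8) =
      (e * e * cnj cis8) * (al * be) + (cnj e * cnj e * cis8) * (cnj al * cnj be)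
      + (e * cnj e) * (al * cnj be * cis8 + cnj al * be * cnj cis8)"
    by (simp add: algebra_simps)
  also have "\<dots> = of_real (2 * X + \<theta>)"
    unfolding X cX ece alcbe alcbe' \<theta>_def by simp
  finally have prod: "(e * al + cnj e * cnj al) * (e * be * cnj cis8 + cnj e * cnj be * cis8) = of_real (2 * X + \<theta>)" .
  have th: "\<theta> * \<theta> = exp (pi * a)" "\<theta> > 0"
    unfolding \<theta>_def by (simp_all flip: exp_add)
  have k0: "weber_k a \<ge> 0"
    unfolding weber_k_def
  proof -
    have "exp (pi * a) = sqrt (exp (2 * pi * a))"
      by (rule real_sqrt_unique[symmetric]) (simp_all add: power2_eq_square flip: exp_add)
    also have "\<dots> \<le> sqrt (1 + exp (2 * pi * a))" by simp
    finally show "0 \<le> sqrt (1 + exp (2 * pi * a)) - exp (pi * a)" by simp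
  qed
  have "exp (pi * a / 4) * exp (pi * a / 4) = \<theta>"
    unfolding \<theta>_def by (simp flip: exp_add)
  then have "(sqrt (weber_k a / 2) * exp (pi * a / 4)) * (sqrt (weber_k a / 2) * exp (pi * a / 4)) = weber_k a / 2 * \<theta>"
    using k0 by (simp add: mult_ac)
  then have KK: "K * K = of_real (weber_k a / 2 * \<theta>)"
    unfolding K_def of_real_mult[symmetric] by (simp only:)
  have "X\<^sup>2 = (pi / 2) / (pi / cosh (pi * a))"
    unfolding X_def power_divide Gamma_half_line_modulus by simp
  also have "\<dots> = (exp (pi * a) + exp (- (pi * a))) / 4"
    by (simp add: cosh_def)
  finally have X2: "X\<^sup>2 = (exp (pi * a) + exp (- (pi * a))) / 4" .
  have e2: "exp (2 * pi * a) = exp (pi * a) * exp (pi * a)" and em: "exp (- (pi * a)) * exp (pi * a) = 1"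
    by (simp_all flip: exp_add)
  \<comment> \<open>As X^2 = cosh(pi a)/2, this brings out the square root in
    \<open>weber_k\<close>.\<close>
  have "(2 * X * \<theta>)\<^sup>2 = 4 * X\<^sup>2 * (\<theta> * \<theta>)" by (simp add: power2_eq_square)
  also have "\<dots> = 1 + exp (2 * pi * a)"
  proof -
    have "4 * ((x + y) / 4) * x = 1 + x * x" if "y * x = 1" for x y :: real
      using that by (simp add: ring_distribs)
    from this[OF em] show ?thesis unfolding X2 th e2 .
  qed
  finally have "2 * X * \<theta> = sqrt (1 + exp (2 * pi * a))"
    using th(2) by (intro real_sqrt_unique[symmetric]) (simp_all add: X_def)
  then have "weber_k a / 2 * \<theta> * (2 * X + \<theta>) = weber_k a / 2 * (sqrt (1 + exp (2 * pi * a)) + exp (pi * a))"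
    unfolding th(1)[symmetric] by (simp add: algebra_simps)
  \<comment> \<open>\<open>weber_k\<close> is the conjugate surd of the bracket, so their product is
    a difference of squares equal to 1.\<close>
  also have "\<dots> = ((sqrt (1 + exp (2 * pi * a)))\<^sup>2 - (exp (pi * a))\<^sup>2) / 2"
    unfolding weber_k_def by (simp only: power2_eq_square) (simp add: algebra_simps)
  also have "\<dots> = 1/2"
  proof -
    have "(sqrt (1 + exp (2 * pi * a)))\<^sup>2 = 1 + exp (2 * pi * a)"
      by (intro real_sqrt_pow2 add_nonneg_nonneg) auto
    then show ?thesis unfolding e2 power2_eq_square by simp
  qed
  finally have fin: "weber_k a / 2 * \<theta> * (2 * X + \<theta>) = 1/2" .
  have "(K * (e * al + cnj e * cnj al)) * (K * (e * be * cnj cis8 + cnj e * cnj be * cis8))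
      = (K * K) * ((e * al + cnj e * cnj al) * (e * be * cnj cis8 + cnj e * cnj be * cis8))"
    by (simp only: mult_ac)
  also have "\<dots> = of_real (weber_k a / 2 * \<theta> * (2 * X + \<theta>))"
    unfolding KK prod of_real_mult ..
  finally show ?thesis unfolding fin al_def be_def by simp
qed

text \<open>Both sides are antisymmetric in a pair of solutions, hence multiples of the one
  expression in E, D and their integrals. The multiples agree by the Wronskian constants of the
  pairs W(a, z), W(a, -z) and \<open>Wj 0\<close>, \<open>Wj 3\<close>.\<close>

lemma NW_eq_Wj:
  "NW a z = \<i> * of_real (exp (pi * a / 2)) *
    (Wj 0 a z * contour_integral (linepath 0 z) (Wj 3 a) - Wj 3 a z * contour_integral (linepath 0 z) (Wj 0 a))"
proof -
  define I where "I f = contour_integral (linepath 0 z) f" for f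
  define E D where "E = weber_even a" and "D = weber_odd a"
  define al be where "al = weber_even_coeff a" and "be = weber_odd_coeff a"
  define e where "e = exp (\<i> * complex_of_real (weber_rho a))"
  define K where "K = complex_of_real (sqrt (weber_k a / 2) * exp (pi * a / 4))"
  define p q where "p = K * (e * al + cnj e * cnj al)" and "q = - (K * (e * be * cnj cis8 + cnj e * cnj be * cis8))"
  have ce: "exp (- \<i> * complex_of_real (weber_rho a)) = cnj e"
    unfolding e_def exp_cnj by simp
  have ci: "E contour_integrable_on linepath 0 z" "D contour_integrable_on linepath 0 z"
    unfolding E_def D_def
    by (auto intro!: contour_integrable_continuous_linepath holomorphic_on_imp_continuous_on
          holomorphic_on_subset[OF weber_even_odd_holomorphic(1)] holomorphic_on_subset[OF weber_even_odd_holomorphic(2)])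
  have lin: "I (\<lambda>t. c * E t + d * D t) = c * I E + d * I D" for c d
    unfolding I_def
    by (subst contour_integral_add) (auto intro!: contour_integrable_lmul ci simp: contour_integral_lmul ci)
  have W0: "Wj 0 a = (\<lambda>t. al * E t + (- (be * cnj cis8)) * D t)"
    unfolding al_def be_def E_def D_def by (rule ext) (simp add: Wj_0_even_odd)
  have W3: "Wj 3 a = (\<lambda>t. cnj al * E t + (- (cnj be * cis8)) * D t)"
    unfolding al_def be_def E_def D_def by (rule ext) (simp add: Wj_3_even_odd)
  have W: "weberW a = (\<lambda>t. p * E t + q * D t)"
    unfolding weberW_def[abs_def] e_def[symmetric] ce K_def[symmetric] W0 W3 p_def q_def
    by (rule ext) (simp add: algebra_simps)
  have Wm: "weberW a (- t) = p * E t + (- q) * D t" for t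
    unfolding W by (simp add: E_def D_def weber_even_minus weber_odd_minus)
  have pq: "p * q = - 1/2"
    using weber_normalization[of a] unfolding p_def q_def e_def K_def al_def be_def by simp
  have "NW a z = (p * E z + q * D z) * (p * I E + (- q) * I D) - (p * E z + (- q) * D z) * (p * I E + q * I D)"
    unfolding NW_def Wm lin[symmetric] unfolding W I_def ..
  \<comment> \<open>The terms with p^2 and q^2 cancel, since z to -z flips only the sign of
    \<open>q\<close>.\<close>
  also have "\<dots> = 2 * (p * q) * (D z * I E - E z * I D)"
    by (simp add: algebra_simps)
  finally have N: "NW a z = E z * I D - D z * I E" unfolding pq by simp
  have c: "al * cnj be * cis8 = of_real (exp (pi * a / 2) / 2) + \<i> * of_real (exp (- (pi * a / 2)) / 2)"
    unfolding al_def be_def weber_even_coeff_def weber_odd_coeff_def by (rule weber_constants)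
  have c': "cnj al * be * cnj cis8 = of_real (exp (pi * a / 2) / 2) - \<i> * of_real (exp (- (pi * a / 2)) / 2)"
    using arg_cong[OF c, of cnj] by simp
  have "complex_of_real (exp (pi * a / 2)) * of_real (exp (- (pi * a / 2))) = 1"
    by (simp flip: of_real_mult exp_add)
  \<comment> \<open>The difference of conjugates keeps the imaginary part i exp(-pi a/2), which the
    prefactor normalises to -1.\<close>
  then have u: "\<i> * complex_of_real (exp (pi * a / 2)) * (al * cnj be * cis8 - cnj al * be * cnj cis8) = - 1"
    unfolding c c' by (simp add: algebra_simps flip: of_real_mult)
  have "\<i> * of_real (exp (pi * a / 2)) * (Wj 0 a z * I (Wj 3 a) - Wj 3 a z * I (Wj 0 a)) =
      \<i> * complex_of_real (exp (pi * a / 2)) * (al * cnj be * cis8 - cnj al * be * cnj cis8) * (D z * I E - E z * I D)"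
    unfolding W0 W3 lin by (simp add: algebra_simps)
  then show ?thesis unfolding u N I_def by simp
qed

text \<open>On Re p = 1/4 the conjugate of \<open>p\<close> is \<open>1/2 - p\<close>, so
  \<open>half_beta_reflection\<close> evaluates the real part of the hypergeometric quantity.
  Trading i Im G for G - Re G, the resulting Gamma term cancels the second summand of
  \<open>c00\<close>.\<close>

lemma c00_eq:
  fixes a :: real
  defines "p \<equiv> 1/4 - \<i> * complex_of_real a / 2"
  shows "c00 a = of_real (exp (pi * a / 2)) * cis8 * (2 powr (- p) * of_real (sqrt pi) * rGamma p * half_beta p)"
proof -
  have p: "0 < Re p" "Re p < 1/2" by (simp_all add: p_def)
  have nz: "Gamma p \<noteq> 0" "p \<noteq> 0" using p by (auto simp: Gamma_eq_zero_iff not_nonpos_Ints)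
  have q: "1/2 - p = 1/4 + \<i> * complex_of_real a / 2" "cnj p = 1/2 - p"
    "5/4 - \<i> * complex_of_real a / 2 = p + 1" "1 - 2 * \<i> * complex_of_real a = 4 * p"
    "5/4 + \<i> * complex_of_real a / 2 = 3/2 - p" "- 5/4 + \<i> * complex_of_real a / 2 = - 1 - p"
    by (simp_all add: p_def complex_eq_iff field_simps)
  \<comment> \<open>The complex number whose imaginary part is \<open>Yfun a\<close>: the factor
    \<open>p\<close> in \<open>gaussF_eq_half_beta\<close> cancels against 1 - 2ia = 4p.\<close>
  define G where "G = of_real (sqrt 2) / 4 * half_beta p"
  have "inverse (4 * p) * gaussF (1/2) 1 (p + 1) (1/2) = G"
    unfolding gaussF_eq_half_beta[OF p(1)] G_def using nz by (simp add: field_simps)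
  then have Y: "Yfun a = Im G" unfolding Yfun_def q by simp
  have cG: "cnj G = of_real (sqrt 2) / 4 * half_beta (1/2 - p)"
    unfolding G_def by (simp add: half_beta_cnj q(2))
  have "\<i> * of_real (Yfun a) = G - (G + cnj G) / 2"
    unfolding Y by (simp add: complex_eq_iff)
  also have "G + cnj G = of_real (sqrt 2) / 4 * (Gamma p * Gamma (1/2 - p) / of_real (sqrt pi))"
    unfolding half_beta_reflection[OF p, symmetric] cG unfolding G_def by (simp add: ring_distribs)
  finally have iY: "\<i> * of_real (Yfun a) = of_real (sqrt 2) / 4 * half_beta p
      - of_real (sqrt 2) / 8 * (Gamma p * Gamma (1/2 - p) / of_real (sqrt pi))"
    unfolding G_def by simp
  have s2: "complex_of_real (sqrt 2) * of_real (sqrt 2) = 2"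
    by (simp flip: of_real_mult)
  have w: "(2::complex) powr (3/2 - p) = 2 * of_real (sqrt 2) * 2 powr (- p)"
    "(2::complex) powr (- 1 - p) = 2 powr (- p) / 2"
  proof -
    have "(2::complex) powr (3/2 - p) = 2 powr (1 + 1/2 + - p)" by simp
    also have "\<dots> = 2 * of_real (sqrt 2) * 2 powr (- p)"
      unfolding powr_add using powr_of_real[of 2 "1/2"] by (simp add: powr_half_sqrt)
    finally show "(2::complex) powr (3/2 - p) = 2 * of_real (sqrt 2) * 2 powr (- p)" .
    have "(2::complex) powr (- 1 - p) = 2 powr (- 1 + - p)" by simp
    then show "(2::complex) powr (- 1 - p) = 2 powr (- p) / 2"
      unfolding powr_add by (simp add: powr_minus_divide)
  qed
  have x: "exp (complex_of_real (pi * a / 2) + pi * \<i> / 4) = of_real (exp (pi * a / 2)) * cis8"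
    unfolding exp_add exp_of_real cis8_def by (simp add: mult.commute)
  \<comment> \<open>The phases of the two summands of \<open>c00\<close> differ by a factor i, which
    joins \<open>Yfun a\<close> to form the quantity in \<open>iY\<close>.\<close>
  have "exp (complex_of_real (pi * a / 2) + 3 * pi * \<i> / 4) = exp (complex_of_real (pi * a / 2)) * (exp (\<i> * of_real (pi / 2)) * cis8)"
    unfolding cis8_def exp_add[symmetric] by (rule arg_cong[of _ _ exp]) (simp add: field_simps)
  also have "exp (\<i> * of_real (pi / 2)) = \<i>" using cis_pi_half by (simp add: cis_conv_exp)
  finally have y: "exp (complex_of_real (pi * a / 2) + 3 * pi * \<i> / 4) = of_real (exp (pi * a / 2)) * (\<i> * cis8)"
    unfolding exp_of_real .
  \<comment> \<open>The letters stand for sqrt pi, sqrt 2, 2^(-p), \<open>half_beta p\<close>,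
    Gamma(p) and Gamma(1/2 - p); S^2 = 2 makes the terms in \<open>h\<close> cancel.\<close>
  have "R * (2 * S * P) * (S / 4 * H - S / 8 * (g * h / R)) / g + P / 2 * h = P * R * (1 / g) * H"
    if "R \<noteq> 0" "g \<noteq> 0" "S * S = 2" for R S P H g h :: complex
  proof -
    have "R * (2 * S * P) * (S / 4 * H - S / 8 * (g * h / R)) / g = (S * S) / 2 * P * R * H / g - (S * S) / 4 * P * h"
      using that(1,2) unfolding right_diff_distrib diff_divide_distrib by (simp add: mult_ac)
    then show ?thesis unfolding that(3) by simp
  qed
  from this[of "of_real (sqrt pi)" "Gamma p" "of_real (sqrt 2)" "2 powr (- p)" "half_beta p" "Gamma (1/2 - p)", OF _ nz(1) s2]
  have z: "of_real (sqrt pi) * (2 * of_real (sqrt 2) * 2 powr (- p)) * (\<i> * of_real (Yfun a)) / Gamma p + 2 powr (- p) / 2 * Gamma (1/2 - p)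
      = 2 powr (- p) * of_real (sqrt pi) * rGamma p * half_beta p"
    unfolding iY rGamma_inverse_Gamma inverse_eq_divide by simp
  have "c00 a = of_real (exp (pi * a / 2)) * cis8 *
     (of_real (sqrt pi) * (2 * of_real (sqrt 2) * 2 powr (- p)) * (\<i> * of_real (Yfun a)) / Gamma p + 2 powr (- p) / 2 * Gamma (1/2 - p))"
    unfolding c00_def x y p_def[symmetric] q(1)[symmetric] q(5,6) w by (simp add: algebra_simps)
  then show ?thesis unfolding z .
qed

text \<open>Along these directions the rotation inside \<open>Wj\<close> cancels, leaving U(ia, s)
  or U(-ia, s) on the positive axis. The values of \<open>p\<close> and \<open>q\<close> solve ia =
  2p - 1/2 and -ia = 2q - 1/2.\<close>

lemma ray_integral_Wj:
  fixes a :: real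
  defines "p \<equiv> 1/4 + \<i> * complex_of_real a / 2" and "q \<equiv> 1/4 - \<i> * complex_of_real a / 2"
  shows "ray_integral (Wj 0 a) z (pi / 4) =
      cis8 * (2 powr (- p) * of_real (sqrt pi) * rGamma p * half_beta p) - contour_integral (linepath 0 z) (Wj 0 a)"
    and "ray_integral (Wj 3 a) z (- pi / 4) =
      cnj cis8 * (2 powr (- q) * of_real (sqrt pi) * rGamma q * half_beta q) - contour_integral (linepath 0 z) (Wj 3 a)"
proof -
  have pq: "Re p > 0" "Re q > 0" "\<i> * of_real a = 2 * p - 1/2" "- \<i> * of_real a = 2 * q - 1/2"
    by (simp_all add: p_def q_def)
  have "Wj 0 a (of_real s * exp (\<i> * complex_of_real (pi / 4))) = pcfU (2 * p - 1/2) (of_real s)" for s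
    unfolding Wj_0 pq(3)[symmetric] cis8_def[symmetric] mult.assoc cis8(3) by simp
  then show "ray_integral (Wj 0 a) z (pi / 4) =
      cis8 * (2 powr (- p) * of_real (sqrt pi) * rGamma p * half_beta p) - contour_integral (linepath 0 z) (Wj 0 a)"
    using ray_integral_eq[OF Wj_holomorphic, of 0 a "pi / 4"] pcfU_half_line_integral[OF pq(1)]
    unfolding cis8_def[symmetric] by simp
  have "cnj cis8 * cis8 = 1" using cis8(3) by (simp add: mult.commute)
  then have "Wj 3 a (of_real s * exp (\<i> * complex_of_real (- pi / 4))) = pcfU (2 * q - 1/2) (of_real s)" for s
    unfolding Wj_3 pq(4)[symmetric] cis8(1) mult.assoc by simp
  then show "ray_integral (Wj 3 a) z (- pi / 4) =
      cnj cis8 * (2 powr (- q) * of_real (sqrt pi) * rGamma q * half_beta q) - contour_integral (linepath 0 z) (Wj 3 a)"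
    using ray_integral_eq[OF Wj_holomorphic, of 3 a "- pi / 4"] pcfU_half_line_integral[OF pq(2)]
    unfolding cis8(1) by simp
qed

theorem theorem2p9:
  fixes a :: real and z :: complex
  shows "NW a z = c00 a * Wj 0 a z + c03 a * Wj 3 a z - NW_hat a z"
proof -
  define p q where "p = 1/4 + \<i> * complex_of_real a / 2" and "q = 1/4 - \<i> * complex_of_real a / 2"
  \<comment> \<open>By \<open>pcfU_half_line_integral\<close>, \<open>J p\<close> is the integral of
    U(2p - 1/2, s) over the positive axis when Re p > 0.\<close>
  define J where "J p = 2 powr (- p) * of_real (sqrt pi) * rGamma p * half_beta p" for p :: complex
  define \<theta> where "\<theta> = complex_of_real (exp (pi * a / 2))"
  have "cnj q = p" by (simp add: p_def q_def)
  then have J: "cnj (J q) = J p"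
    unfolding J_def using cnj_powr_of_real[of 2 "- q"] by (simp add: half_beta_cnj cnj_rGamma)
  \<comment> \<open>Writing \<open>cis8\<close> as \<open>i * cnj cis8\<close> exhibits
    \<open>c00 a\<close> as the coefficient of \<open>Wj 0\<close> left over in
    \<open>NW + NW_hat\<close>; conjugation then gives that of \<open>Wj 3\<close>.\<close>
  have c0: "c00 a = \<theta> * (\<i> * cnj cis8) * J q"
    unfolding c00_eq J_def q_def \<theta>_def cis8(6) ..
  have "c03 a = \<theta> * (- \<i> * cis8) * J p"
    unfolding c03_def c0 complex_cnj_mult J by (simp add: \<theta>_def)
  moreover have "NW_hat a z = \<i> * \<theta> * (Wj 3 a z * (contour_integral (linepath 0 z) (Wj 0 a) - cis8 * J p)
      - Wj 0 a z * (contour_integral (linepath 0 z) (Wj 3 a) - cnj cis8 * J q))"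
    unfolding NW_hat_def ray_integral_Wj J_def p_def q_def \<theta>_def exp_of_real by simp
  ultimately show ?thesis
    unfolding NW_eq_Wj c0 \<theta>_def[symmetric] by (simp add: algebra_simps)
qed

end
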